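(* Let $A$ be an infinite dimensional simple unital C*-algebra, and let $B \subset A$ be a large subalgebra. Then $A$ is purely infinite if and only if $B$ is purely infinite.
   Context: Subalgebras are C*-subalgebras; a unital subalgebra of $A$ contains the identity of $A$. For a C*-algebra $D$ and $a, b \in D_{+}$ (positive elements), $a \precsim_D b$ (Cuntz subequivalence) means there is a sequence $(v_n)$ in $D$ with $\lim_{n \to \infty} v_n b v_n^* = a$. Large subalgebra: let $A$ be an infinite dimensional simple unital C*-algebra. A unital subalgebra $B \subset A$ is large in $A$ if for every integer $m \geq 1$, $a_1, \ldots, a_m \in A$, $\varepsilon > 0$, $x \in A_{+}$ with $\|x\| = 1$, and $y \in B_{+} \setminus \{0\}$, there are $c_1, \ldots, c_m \in A$ and $g \in B$ such that: (1) $0 \leq g \leq 1$; (2) $\|c_j - a_j\| < \varepsilon$ for $j = 1, \ldots, m$; (3) $(1-g) c_j \in B$ for $j = 1, \ldots, m$; (4) $g \precsim_B y$ and $g \precsim_A x$; (5) $\|(1-g) x (1-g)\| > 1 - \varepsilon$. A large subalgebra of an infinite dimensional simple unital C*-algebra is itself simple. A simple C*-algebra is purely infinite if every nonzero hereditary subalgebra contains an infinite projection. *)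

theory Defs
  imports "HOL-Analysis.Analysis"
begin

text \<open>A unital C*-algebra. Its unit is nonzero and has norm 1 by the class
  \<open>real_normed_algebra_1\<close>; this excludes only the zero algebra.\<close>

class unital_cstar_algebra = real_normed_algebra_1 + banach +
  fixes scaleC :: "complex \<Rightarrow> 'a \<Rightarrow> 'a" (infixr "*\<^sub>C" 75)
    and star :: "'a \<Rightarrow> 'a" ("_\<^sup>\<star>" [1000] 999)
  assumes scaleC_add_right: "z *\<^sub>C (x + y) = z *\<^sub>C x + z *\<^sub>C y"
    and scaleC_add_left: "(z + w) *\<^sub>C x = z *\<^sub>C x + w *\<^sub>C x"
    and scaleC_scaleC: "z *\<^sub>C w *\<^sub>C x = (z * w) *\<^sub>C x"
    and scaleC_one: "1 *\<^sub>C x = x"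
    and scaleR_scaleC: "r *\<^sub>R x = complex_of_real r *\<^sub>C x"
    and mult_scaleC_left: "(z *\<^sub>C x) * y = z *\<^sub>C (x * y)"
    and mult_scaleC_right: "x * (z *\<^sub>C y) = z *\<^sub>C (x * y)"
    and norm_scaleC: "norm (z *\<^sub>C x) = cmod z * norm x"
    and star_add: "(x + y)\<^sup>\<star> = x\<^sup>\<star> + y\<^sup>\<star>"
    and star_scaleC: "(z *\<^sub>C x)\<^sup>\<star> = cnj z *\<^sub>C x\<^sup>\<star>"
    and star_mult: "(x * y)\<^sup>\<star> = y\<^sup>\<star> * x\<^sup>\<star>"
    and star_star: "(x\<^sup>\<star>)\<^sup>\<star> = x"
    and norm_star_mult: "norm (x\<^sup>\<star> * x) = (norm x)\<^sup>2"

global_interpretation complex_vector: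
  vector_space "scaleC :: complex \<Rightarrow> 'a \<Rightarrow> 'a::unital_cstar_algebra"
  by unfold_locales (simp_all add: scaleC_add_right scaleC_add_left scaleC_scaleC scaleC_one)

text \<open>Throughout, a type \<open>'a\<close> of class \<open>unital_cstar_algebra\<close> is the ambient algebra and its
  C*-subalgebras are sets. The predicates below take such a set \<open>D\<close> and are intrinsic to \<open>D\<close>;
  the ambient algebra itself is \<open>UNIV\<close>.\<close>

definition cstar_subalgebra :: "'a::unital_cstar_algebra set \<Rightarrow> bool" where
  "cstar_subalgebra D \<longleftrightarrow> complex_vector.subspace D \<and> closed D \<and>
     (\<forall>x\<in>D. \<forall>y\<in>D. x * y \<in> D) \<and> (\<forall>x\<in>D. x\<^sup>\<star> \<in> D)"

definition unital_subalgebra :: "'a::unital_cstar_algebra set \<Rightarrow> bool" where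
  "unital_subalgebra D \<longleftrightarrow> cstar_subalgebra D \<and> 1 \<in> D"

definition infinite_dimensional :: "'a::unital_cstar_algebra set \<Rightarrow> bool" where
  "infinite_dimensional D \<longleftrightarrow> \<not> (\<exists>S. finite S \<and> S \<subseteq> D \<and> D \<subseteq> complex_vector.span S)"

definition closed_ideal :: "'a::unital_cstar_algebra set \<Rightarrow> 'a set \<Rightarrow> bool" where
  "closed_ideal D I \<longleftrightarrow> I \<subseteq> D \<and> complex_vector.subspace I \<and> closed I \<and>
     (\<forall>x\<in>D. \<forall>y\<in>I. x * y \<in> I \<and> y * x \<in> I)"

definition simple_cstar :: "'a::unital_cstar_algebra set \<Rightarrow> bool" where
  "simple_cstar D \<longleftrightarrow> D \<noteq> {0} \<and> (\<forall>I. closed_ideal D I \<longrightarrow> I = {0} \<or> I = D)"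

text \<open>The spectrum, and hence positivity, is taken relative to \<open>D\<close>; these two definitions, and
  the notions depending on them, are meant for \<open>D\<close> containing the unit \<open>1\<close> of the ambient
  algebra.\<close>

definition spectrum :: "'a::unital_cstar_algebra set \<Rightarrow> 'a \<Rightarrow> complex set" where
  "spectrum D a = {z. \<not> (\<exists>b\<in>D. b * (a - z *\<^sub>C 1) = 1 \<and> (a - z *\<^sub>C 1) * b = 1)}"

definition positives :: "'a::unital_cstar_algebra set \<Rightarrow> 'a set" where
  "positives D = {a\<in>D. a\<^sup>\<star> = a \<and> spectrum D a \<subseteq> complex_of_real ` {0..}}"

definition cstar_le :: "'a::unital_cstar_algebra set \<Rightarrow> 'a \<Rightarrow> 'a \<Rightarrow> bool" where
  "cstar_le D a b \<longleftrightarrow> b - a \<in> positives D"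

definition cuntz_subequiv :: "'a::unital_cstar_algebra set \<Rightarrow> 'a \<Rightarrow> 'a \<Rightarrow> bool" where
  "cuntz_subequiv D a b \<longleftrightarrow>
     (\<exists>v :: nat \<Rightarrow> 'a. (\<forall>n. v n \<in> D) \<and> (\<lambda>n. v n * b * (v n)\<^sup>\<star>) \<longlonglongrightarrow> a)"

definition large_subalgebra :: "'a::unital_cstar_algebra set \<Rightarrow> bool" where
  "large_subalgebra B \<longleftrightarrow> unital_subalgebra B \<and>
     (\<forall>(m::nat) (a :: nat \<Rightarrow> 'a) (\<epsilon>::real) x y.
        m \<ge> 1 \<and> \<epsilon> > 0 \<and> x \<in> positives UNIV \<and> norm x = 1 \<and> y \<in> positives B - {0} \<longrightarrow>
        (\<exists>(c :: nat \<Rightarrow> 'a) g. g \<in> B \<and>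
           cstar_le B 0 g \<and> cstar_le B g 1 \<and>
           (\<forall>j\<in>{1..m}. norm (c j - a j) < \<epsilon>) \<and>
           (\<forall>j\<in>{1..m}. (1 - g) * c j \<in> B) \<and>
           cuntz_subequiv B g y \<and> cuntz_subequiv UNIV g x \<and>
           norm ((1 - g) * x * (1 - g)) > 1 - \<epsilon>))"

definition hereditary_subalgebra :: "'a::unital_cstar_algebra set \<Rightarrow> 'a set \<Rightarrow> bool" where
  "hereditary_subalgebra D H \<longleftrightarrow> cstar_subalgebra H \<and> H \<subseteq> D \<and>
     (\<forall>a\<in>D. \<forall>b\<in>H. cstar_le D 0 a \<and> cstar_le D a b \<longrightarrow> a \<in> H)"

definition projections :: "'a::unital_cstar_algebra set \<Rightarrow> 'a set" where
  "projections D = {p\<in>D. p\<^sup>\<star> = p \<and> p * p = p}"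

definition mvn_equiv :: "'a::unital_cstar_algebra set \<Rightarrow> 'a \<Rightarrow> 'a \<Rightarrow> bool" where
  "mvn_equiv D p q \<longleftrightarrow> (\<exists>v\<in>D. v\<^sup>\<star> * v = p \<and> v * v\<^sup>\<star> = q)"

definition infinite_projection :: "'a::unital_cstar_algebra set \<Rightarrow> 'a \<Rightarrow> bool" where
  "infinite_projection D p \<longleftrightarrow> p \<in> projections D \<and>
     (\<exists>q\<in>projections D. cstar_le D q p \<and> q \<noteq> p \<and> mvn_equiv D p q)"

text \<open>Pure infiniteness is used in the sense of simple algebras, so simplicity is part of the
  predicate.\<close>

definition purely_infinite :: "'a::unital_cstar_algebra set \<Rightarrow> bool" where
  "purely_infinite D \<longleftrightarrow> simple_cstar D \<and>
     (\<forall>H. hereditary_subalgebra D H \<and> H \<noteq> {0} \<longrightarrow> (\<exists>p\<in>H. infinite_projection D p))"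

end

theory Submission
  imports Defs
begin

text \<open>For a unital subalgebra \<open>D\<close>, pure infiniteness is equivalent to two conditions: for every nonzero
  positive \<open>b\<close> in \<open>D\<close> some \<open>v\<close> in \<open>D\<close> has \<open>v b v\<^sup>\<star> = 1\<close>, and \<open>D\<close> contains a non-unitary isometry.
  Both are transferred between \<open>A\<close> and \<open>B\<close>.

  From \<open>B\<close> to \<open>A\<close>: for positive \<open>x\<close> of norm \<open>1\<close>, largeness approximates \<open>(1 - g) x\<^sup>1\<^sup>/\<^sup>2\<close> by an element \<open>d\<close>
  of \<open>B\<close> for which \<open>d d\<^sup>\<star>\<close> has norm close to \<open>1\<close>; compressing \<open>d d\<^sup>\<star>\<close> within \<open>B\<close> to something above
  \<open>1/2\<close> compresses \<open>x\<close> to an invertible element.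

  From \<open>A\<close> to \<open>B\<close>: below \<open>b\<close> there are orthogonal nonzero elements \<open>P\<close> and \<open>N\<close> of \<open>B\<close>. In \<open>A\<close>, the
  unit is subequivalent to \<open>P\<^sup>4\<close>; largeness moves this into \<open>B\<close> up to the factor \<open>1 - g\<close>, where
  \<open>g\<close> is subequivalent to \<open>N\<^sup>4\<close> in \<open>B\<close>. Since \<open>(1 - g)\<^sup>2 + g \<ge> 3/4\<close>, the two pieces together
  cover the unit.\<close>

section \<open>Involution, invertibility and spectral permanence\<close>

text \<open>The first condition alone also holds for the scalars; the isometry excludes them.

  In the direction from \<open>A\<close> to \<open>B\<close> the obstacle is that largeness puts
  only \<open>(1 - g) c\<close> into \<open>B\<close>, and \<open>1 - g\<close> need not be
  invertible. What is lost to \<open>g\<close> has to be recovered inside \<open>B\<close> from an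
  element that does not interact with \<open>P\<close>; hence the orthogonal \<open>N\<close>. Both
  are taken as parts of one self-adjoint \<open>h = b l b\<close> with \<open>l\<close> in
  \<open>B\<close>: then \<open>P h = P^2\<close> and \<open>N h = - N^2\<close>, so both squares
  factor through \<open>b\<close>, and the sum of the two pieces has the form \<open>X h Y\<close>.
  For \<open>P\<close> and \<open>N\<close> to be nonzero, neither \<open>h\<close> nor
  \<open>- h\<close> may be positive.

  Estimates need only reach a fixed positive lower bound, because an element bounded below by a
  positive constant can be normalised to \<open>1\<close>. Cut-downs that a functional calculus
  would provide are replaced by positive and negative parts built from a square root. Positivity is
  defined by a relative spectrum, so it is first made independent of the subalgebra and then turned
  into norm inequalities.\<close>

lemma of_real_eq_scaleC: "of_real r = complex_of_real r *\<^sub>C (1::'a::unital_cstar_algebra)"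
  by (simp add: of_real_def scaleR_scaleC)

lemma star_zero [simp]: "0\<^sup>\<star> = (0::'a::unital_cstar_algebra)"
  using star_scaleC [of 0 "0::'a"] by simp

lemma star_minus [simp]: "(- x)\<^sup>\<star> = - (x::'a::unital_cstar_algebra)\<^sup>\<star>"
  using star_add [of x "-x"] by (simp add: eq_neg_iff_add_eq_0 add.commute)

lemma star_diff: "(x - y)\<^sup>\<star> = (x::'a::unital_cstar_algebra)\<^sup>\<star> - y\<^sup>\<star>"
  using star_add [of x "-y"] by simp

lemma star_one [simp]: "1\<^sup>\<star> = (1::'a::unital_cstar_algebra)"
  by (metis mult_1_left mult_1_right star_mult star_star)

lemma star_scaleR: "(r *\<^sub>R x)\<^sup>\<star> = r *\<^sub>R (x::'a::unital_cstar_algebra)\<^sup>\<star>"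
  by (simp add: scaleR_scaleC star_scaleC)

lemma star_of_real [simp]: "(of_real r)\<^sup>\<star> = (of_real r::'a::unital_cstar_algebra)"
  by (simp add: of_real_def star_scaleR)

lemma star_power: "(x ^ n)\<^sup>\<star> = (x::'a::unital_cstar_algebra)\<^sup>\<star> ^ n"
  by (induction n) (simp_all add: star_mult power_commutes)

lemmas star_simps = star_add star_diff star_mult star_star star_scaleR star_power

lemma norm_star [simp]: "norm (x\<^sup>\<star>) = norm (x::'a::unital_cstar_algebra)"
proof -
  have *: "norm y \<le> norm (y\<^sup>\<star>)" for y :: 'a
  proof (cases "y = 0")
    case False
    have "norm y * norm y \<le> norm (y\<^sup>\<star>) * norm y"
      using norm_mult_ineq [of "y\<^sup>\<star>" y] norm_star_mult [of y] by (simp add: power2_eq_square)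
    with False show ?thesis by simp
  qed auto
  show ?thesis using * [of x] * [of "x\<^sup>\<star>"] by (simp add: star_star)
qed

lemma norm_mult_star: "norm (x * x\<^sup>\<star>) = (norm (x::'a::unital_cstar_algebra))\<^sup>2"
  using norm_star_mult [of "x\<^sup>\<star>"] by (simp add: star_star)

lemma norm_sa_square: "a\<^sup>\<star> = a \<Longrightarrow> norm (a * a) = (norm (a::'a::unital_cstar_algebra))\<^sup>2"
  using norm_star_mult [of a] by simp

lemma bounded_linear_star: "bounded_linear (star :: 'a::unital_cstar_algebra \<Rightarrow> 'a)"
  by (rule bounded_linear_intro [where K = 1]) (simp_all add: star_add star_scaleR)

lemmas tendsto_star [tendsto_intros] = bounded_linear.tendsto [OF bounded_linear_star]

lemma tendsto_scaleC [tendsto_intros]: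
  "(f \<longlongrightarrow> a) F \<Longrightarrow> ((\<lambda>n. z *\<^sub>C f n) \<longlongrightarrow> z *\<^sub>C (a::'a::unital_cstar_algebra)) F"
proof -
  have "bounded_linear (scaleC z :: 'a \<Rightarrow> 'a)"
    by (rule bounded_linear_intro [where K = "cmod z"])
      (simp_all add: scaleC_add_right scaleR_scaleC scaleC_scaleC mult.commute norm_scaleC)
  then show "(f \<longlongrightarrow> a) F \<Longrightarrow> ?thesis" by (rule bounded_linear.tendsto)
qed

context
  fixes D :: "'a::unital_cstar_algebra set"
  assumes D: "unital_subalgebra D"
begin

lemma sub_one [simp]: "1 \<in> D"
  using D by (simp add: unital_subalgebra_def)

lemma sub_closed: "closed D"
  using D by (simp add: unital_subalgebra_def cstar_subalgebra_def)

lemma sub_mult: "x \<in> D \<Longrightarrow> y \<in> D \<Longrightarrow> x * y \<in> D"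
  using D by (simp add: unital_subalgebra_def cstar_subalgebra_def)

lemma sub_star: "x \<in> D \<Longrightarrow> x\<^sup>\<star> \<in> D"
  using D by (simp add: unital_subalgebra_def cstar_subalgebra_def)

lemma sub_subspace: "complex_vector.subspace D"
  using D by (simp add: unital_subalgebra_def cstar_subalgebra_def)

lemma sub_add: "x \<in> D \<Longrightarrow> y \<in> D \<Longrightarrow> x + y \<in> D"
  using sub_subspace by (rule complex_vector.subspace_add)

lemma sub_diff: "x \<in> D \<Longrightarrow> y \<in> D \<Longrightarrow> x - y \<in> D"
  using sub_subspace by (rule complex_vector.subspace_diff)

lemma sub_zero [simp]: "0 \<in> D"
  using sub_subspace by (rule complex_vector.subspace_0)

lemma sub_scaleC: "x \<in> D \<Longrightarrow> z *\<^sub>C x \<in> D"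
  using sub_subspace by (rule complex_vector.subspace_scale)

lemma sub_scaleR: "x \<in> D \<Longrightarrow> r *\<^sub>R x \<in> D"
  by (simp add: scaleR_scaleC sub_scaleC)

lemma sub_of_real: "of_real r \<in> D"
  by (simp add: of_real_def sub_scaleR)

lemma sub_power: "x \<in> D \<Longrightarrow> x ^ n \<in> D"
  by (induction n) (simp_all add: sub_mult)

lemma sub_limit: "(\<And>n. f n \<in> D) \<Longrightarrow> f \<longlonglongrightarrow> a \<Longrightarrow> a \<in> D"
  using sub_closed closed_sequentially by blast

lemmas sub_intros = sub_mult sub_star sub_add sub_diff sub_scaleC sub_scaleR sub_of_real sub_power

end

lemma unital_subalgebra_UNIV: "unital_subalgebra (UNIV :: 'a::unital_cstar_algebra set)"
  by (simp add: unital_subalgebra_def cstar_subalgebra_def)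

section \<open>Invertibility relative to a subalgebra\<close>

definition invertible_in :: "'a::unital_cstar_algebra set \<Rightarrow> 'a \<Rightarrow> bool" where
  "invertible_in D a \<longleftrightarrow> (\<exists>b\<in>D. b * a = 1 \<and> a * b = 1)"

lemma not_in_spectrum: "z \<notin> spectrum D a \<longleftrightarrow> invertible_in D (a - z *\<^sub>C 1)"
  by (simp add: spectrum_def invertible_in_def)

lemma invertible_in_scaleC:
  assumes "unital_subalgebra D" and "invertible_in D a" and "z \<noteq> 0"
  shows "invertible_in D (z *\<^sub>C a)"
proof -
  obtain b where b: "b \<in> D" "b * a = 1" "a * b = 1"
    using assms(2) by (auto simp: invertible_in_def)
  have "inverse z *\<^sub>C b \<in> D" using assms(1) b(1) by (rule sub_scaleC)
  with b assms(3) show ?thesis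
    unfolding invertible_in_def
    by (intro bexI [of _ "inverse z *\<^sub>C b"])
      (simp_all add: mult_scaleC_left mult_scaleC_right scaleC_scaleC scaleC_one)
qed

lemma neumann:
  assumes D: "unital_subalgebra D" and x: "x \<in> D" "norm (1 - x) < 1"
  shows "invertible_in D x"
proof -
  let ?y = "1 - x"
  have s: "summable (\<lambda>n. ?y ^ n)"
    using x(2) by (rule complete_algebra_summable_geometric)
  define b where "b = (\<Sum>n. ?y ^ n)"
  have lim: "(\<lambda>n. \<Sum>i<n. ?y ^ i) \<longlonglongrightarrow> b"
    using s unfolding b_def by (rule summable_LIMSEQ)
  have "(\<Sum>i<n. ?y ^ i) \<in> D" for n
    using D x(1) by (induction n) (auto intro!: sub_intros)
  then have "b \<in> D" using lim by (rule sub_limit [OF D])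
  have p0: "(\<lambda>n. ?y ^ n) \<longlonglongrightarrow> 0"
    using x(2) by (rule LIMSEQ_power_zero)
  have eq: "(\<Sum>i<n. ?y ^ i) * x = 1 - ?y ^ n" "x * (\<Sum>i<n. ?y ^ i) = 1 - ?y ^ n" for n
    using power_commutes [of ?y] by (induction n) (simp_all add: algebra_simps)
  have "(\<lambda>n. 1 - ?y ^ n) \<longlonglongrightarrow> b * x"
    using tendsto_mult_right [OF lim, of x] by (simp add: eq)
  moreover have "(\<lambda>n. 1 - ?y ^ n) \<longlonglongrightarrow> x * b"
    using tendsto_mult_left [OF lim, of x] by (simp add: eq)
  moreover have "(\<lambda>n. 1 - ?y ^ n) \<longlonglongrightarrow> 1 - 0"
    by (intro tendsto_intros p0)
  ultimately have "b * x = 1" "x * b = 1"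
    by (metis LIMSEQ_unique diff_zero)+
  with \<open>b \<in> D\<close> show ?thesis by (auto simp: invertible_in_def)
qed

lemma invertible_in_minus_scalar:
  assumes D: "unital_subalgebra D" and x: "x \<in> D" "norm x < cmod w"
  shows "invertible_in D (x - w *\<^sub>C 1)"
proof -
  have w: "w \<noteq> 0" using x(2) by auto
  have "norm (inverse w *\<^sub>C x) < 1"
    using x(2) w by (simp add: norm_scaleC norm_inverse norm_divide field_simps)
  then have "invertible_in D (1 - inverse w *\<^sub>C x)"
    using D x(1) by (intro neumann) (auto intro!: sub_intros)
  then have "invertible_in D ((- w) *\<^sub>C (1 - inverse w *\<^sub>C x))"
    using D w by (intro invertible_in_scaleC) auto
  moreover have "(- w) *\<^sub>C (1 - inverse w *\<^sub>C x) = x - w *\<^sub>C 1"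
    using w by (simp add: complex_vector.scale_right_diff_distrib scaleC_scaleC scaleC_one)
  ultimately show ?thesis by simp
qed

text \<open>Arens' trick: shifting by a large imaginary number makes the norm of \<open>a\<close> grow more
  slowly than the modulus of the scalar.\<close>
lemma invertible_in_sa_nonreal:
  assumes D: "unital_subalgebra D" and a: "a \<in> D" "a\<^sup>\<star> = a" and z: "Im z \<noteq> 0"
  shows "invertible_in D (a - z *\<^sub>C 1)"
proof -
  define c where "c = a - of_real (Re z)"
  define \<beta> where "\<beta> = Im z"
  \<comment> \<open>With this \<open>t\<close>, \<open>2 * \<beta> * t\<close> is twice the square
    of \<open>norm c\<close>, so \<open>(\<beta> + t)^2\<close> strictly exceeds the bound on the
    square of \<open>norm y\<close>.\<close>
  define t where "t = (norm c)\<^sup>2 / \<beta>"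
  define y where "y = c + (\<i> * of_real t) *\<^sub>C 1"
  have b0: "\<beta> \<noteq> 0" using z by (simp add: \<beta>_def)
  have "y\<^sup>\<star> * y = c * c + of_real (t\<^sup>2)"
    by (simp add: y_def c_def a star_simps star_scaleC algebra_simps mult_scaleC_left
        mult_scaleC_right scaleC_scaleC of_real_eq_scaleC power2_eq_square)
  then have "(norm y)\<^sup>2 \<le> (norm c)\<^sup>2 + t\<^sup>2"
    using norm_star_mult [of y] norm_triangle_ineq [of "c * c" "of_real (t\<^sup>2)"] norm_mult_ineq [of c c]
    by (simp add: power2_eq_square flip: of_real_mult)
  also have "\<dots> < (\<beta> + t)\<^sup>2"
  proof -
    have "(\<beta> + t)\<^sup>2 = \<beta>\<^sup>2 + 2 * (norm c)\<^sup>2 + t\<^sup>2"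
      using b0 by (simp add: t_def power2_eq_square field_simps)
    moreover have "\<beta>\<^sup>2 > 0" using b0 by simp
    moreover have "(norm c)\<^sup>2 \<ge> 0" by simp
    ultimately show ?thesis by linarith
  qed
  finally have "norm y < \<bar>\<beta> + t\<bar>"
    by (metis abs_norm_cancel abs_le_square_iff not_le)
  then have "norm y < cmod (\<i> * of_real (\<beta> + t))"
    by (simp only: norm_mult norm_of_real) simp
  moreover have "y \<in> D"
    unfolding y_def c_def using D a by (auto intro!: sub_intros)
  ultimately have "invertible_in D (y - (\<i> * of_real (\<beta> + t)) *\<^sub>C 1)"
    by (intro invertible_in_minus_scalar D)
  moreover have "y - (\<i> * of_real (\<beta> + t)) *\<^sub>C 1 = a - (of_real (Re z) + \<i> * of_real \<beta>) *\<^sub>C 1"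
    by (simp add: y_def c_def of_real_eq_scaleC scaleC_add_left algebra_simps)
  ultimately show ?thesis
    using complex_eq [of z] by (simp add: \<beta>_def)
qed

text \<open>Resolvent identity \<open>b' - b = b' (u - u') b\<close>; the smallness assumption
  bounds \<open>norm b'\<close> by \<open>2 * norm b\<close>.\<close>

lemma norm_inverse_diff:
  fixes u u' b b' :: "'a::unital_cstar_algebra"
  assumes "u * b = 1" and "b' * u' = 1" and small: "norm (u' - u) * norm b \<le> 1/2"
  shows "norm (b' - b) \<le> 2 * (norm b)\<^sup>2 * norm (u' - u)"
proof -
  have "b' * u * b = b'" "b' * u' * b = b"
    using assms(1,2) by (simp_all add: mult.assoc)
  then have diff: "b' - b = b' * ((u - u') * b)"
    by (simp add: algebra_simps)
  have "norm ((u - u') * b) \<le> norm (u' - u) * norm b"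
    using norm_mult_ineq [of "u - u'" b] norm_minus_commute [of u u'] by simp
  then have nd: "norm (b' - b) \<le> norm b' * (norm (u' - u) * norm b)"
    unfolding diff by (meson mult_left_mono norm_ge_zero norm_mult_ineq order_trans)
  also have "\<dots> \<le> norm b' * (1/2)"
    using small by (intro mult_left_mono) auto
  finally have "norm b' \<le> 2 * norm b"
    using norm_triangle_sub [of b' b] by simp
  then have "norm b' * (norm (u' - u) * norm b) \<le> 2 * norm b * (norm (u' - u) * norm b)"
    by (intro mult_right_mono) auto
  with nd show ?thesis by (simp add: power2_eq_square mult_ac)
qed

text \<open>The ambient inverse is the limit of the inverses of \<open>c - i e\<close>,
  \<open>e\<close> tending to \<open>0\<close>, and these lie in \<open>D\<close> because
  \<open>i e\<close> is not real.\<close>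

lemma invertible_in_sa_permanence:
  assumes D: "unital_subalgebra D" and c: "c \<in> D" "c\<^sup>\<star> = c" and inv: "invertible_in UNIV c"
  shows "invertible_in D c"
proof -
  obtain y where y: "y * c = 1" "c * y = 1"
    using inv by (auto simp: invertible_in_def)
  define e where "e n = inverse (real (Suc n))" for n
  have e0: "e \<longlonglongrightarrow> 0" unfolding e_def by (rule LIMSEQ_inverse_real_of_nat)
  have epos: "e n > 0" for n by (simp add: e_def)
  have "\<exists>b\<in>D. b * (c - (\<i> * of_real (e n)) *\<^sub>C 1) = 1" for n
    using invertible_in_sa_nonreal [OF D c, of "\<i> * of_real (e n)"] epos [of n]
    by (auto simp: invertible_in_def)
  then obtain b where b: "\<And>n. b n \<in> D" "\<And>n. b n * (c - (\<i> * of_real (e n)) *\<^sub>C 1) = 1"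
    by metis
  have ne: "norm (c - (\<i> * of_real (e n)) *\<^sub>C 1 - c) = e n" for n
    using epos [of n] by (simp add: norm_scaleC norm_mult)
  have "(\<lambda>n. e n * norm y) \<longlonglongrightarrow> 0"
    using e0 by (rule tendsto_mult_left_zero)
  then have "eventually (\<lambda>n. e n * norm y < 1/2) sequentially"
    by (intro order_tendstoD(2) [where y = 0]) simp_all
  then have "eventually (\<lambda>n. norm (b n - y) \<le> 2 * (norm y)\<^sup>2 * e n) sequentially"
  proof (rule eventually_mono)
    fix n assume "e n * norm y < 1/2"
    then show "norm (b n - y) \<le> 2 * (norm y)\<^sup>2 * e n"
      using norm_inverse_diff [OF y(2) b(2) [of n]] by (simp only: ne)
  qed
  moreover have "(\<lambda>n. 2 * (norm y)\<^sup>2 * e n) \<longlonglongrightarrow> 0"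
    using e0 by (rule tendsto_mult_right_zero)
  ultimately have "(\<lambda>n. b n - y) \<longlonglongrightarrow> 0"
    by (rule Lim_null_comparison)
  then have "b \<longlonglongrightarrow> y" by (simp add: LIM_zero_iff)
  with b(1) have "y \<in> D" by (rule sub_limit [OF D])
  with y show ?thesis by (auto simp: invertible_in_def)
qed

lemma spectrum_sa_eq:
  assumes "unital_subalgebra D" "a \<in> D" "a\<^sup>\<star> = a"
  shows "spectrum D a = spectrum UNIV a"
proof -
  have "invertible_in D (a - z *\<^sub>C 1) \<longleftrightarrow> invertible_in UNIV (a - z *\<^sub>C 1)" for z
  proof (cases "Im z = 0")
    case False
    then show ?thesis using assms invertible_in_sa_nonreal unital_subalgebra_UNIV by blast
  next
    case True
    then have z: "z *\<^sub>C 1 = (of_real (Re z) :: 'a)"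
      by (simp add: of_real_eq_scaleC complex_is_Real_iff)
    have "a - of_real (Re z) \<in> D" "(a - of_real (Re z))\<^sup>\<star> = a - of_real (Re z)"
      using assms by (simp_all add: star_simps sub_diff sub_of_real)
    then show ?thesis
      unfolding z using invertible_in_sa_permanence [OF assms(1)] by (auto simp: invertible_in_def)
  qed
  then show ?thesis by (auto simp flip: not_in_spectrum)
qed

text \<open>Spectral permanence removes the dependence on \<open>D\<close>: later order arguments
  take place in the ambient algebra, and only membership in \<open>D\<close> is tracked.\<close>

lemma positives_eq:
  assumes "unital_subalgebra D"
  shows "positives D = D \<inter> positives UNIV"
proof -
  have "a \<in> positives D \<longleftrightarrow> a \<in> D \<inter> positives UNIV" for a
    by (cases "a \<in> D \<and> a\<^sup>\<star> = a") (auto simp: positives_def spectrum_sa_eq [OF assms])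
  then show ?thesis by blast
qed

lemma cstar_le_iff:
  "unital_subalgebra D \<Longrightarrow> a \<in> D \<Longrightarrow> b \<in> D \<Longrightarrow> cstar_le D a b \<longleftrightarrow> b - a \<in> positives UNIV"
  by (simp add: cstar_le_def positives_eq sub_diff)

text \<open>Non-real numbers are never in the spectrum of a self-adjoint element, so only negative
  reals have to be excluded.\<close>

lemma positives_iff:
  "a \<in> positives UNIV \<longleftrightarrow> a\<^sup>\<star> = a \<and> (\<forall>t>0. invertible_in UNIV (a + of_real t))"
  for a :: "'a::unital_cstar_algebra"
proof
  assume a: "a \<in> positives UNIV"
  have "complex_of_real (- t) \<notin> spectrum UNIV a" if "t > 0" for t
    using a that by (auto simp: positives_def)
  then show "a\<^sup>\<star> = a \<and> (\<forall>t>0. invertible_in UNIV (a + of_real t))"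
    using a by (simp add: positives_def not_in_spectrum of_real_eq_scaleC)
next
  assume a: "a\<^sup>\<star> = a \<and> (\<forall>t>0. invertible_in UNIV (a + of_real t))"
  have "z \<in> complex_of_real ` {0..}" if z: "z \<in> spectrum UNIV a" for z
  proof -
    have im: "Im z = 0"
      using invertible_in_sa_nonreal [OF unital_subalgebra_UNIV, of a z] z a
      by (auto simp: not_in_spectrum [symmetric])
    then have zr: "z = complex_of_real (Re z)" by (simp add: complex_eq_iff)
    have "invertible_in UNIV (a - z *\<^sub>C 1)" if "Re z < 0"
    proof -
      have "a - z *\<^sub>C 1 = a + of_real (- Re z)"
        by (subst zr) (simp add: of_real_eq_scaleC)
      moreover have "invertible_in UNIV (a + of_real (- Re z))"
        using a that by (metis neg_0_less_iff_less)
      ultimately show ?thesis by metis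
    qed
    then have "Re z \<ge> 0" using z not_in_spectrum by (metis not_le)
    with zr show ?thesis by (metis atLeast_iff imageI)
  qed
  with a show "a \<in> positives UNIV" by (auto simp: positives_def)
qed

section \<open>The positive cone\<close>

lemma invertible_in_mult:
  assumes "unital_subalgebra D" "invertible_in D a" "invertible_in D b"
  shows "invertible_in D (a * b)"
proof -
  obtain a' b' where *: "a' \<in> D" "b' \<in> D" "a' * a = 1" "a * a' = 1" "b' * b = 1" "b * b' = 1"
    using assms(2,3) by (auto simp: invertible_in_def)
  have "b' * a' * (a * b) = b' * (a' * a) * b" "a * b * (b' * a') = a * (b * b') * a'"
    by (simp_all only: mult.assoc)
  with * sub_mult [OF assms(1)] show ?thesis
    unfolding invertible_in_def by (intro bexI [of _ "b' * a'"]) auto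
qed

lemma scaleC_power: "(z *\<^sub>C x) ^ n = z ^ n *\<^sub>C (x::'a::unital_cstar_algebra) ^ n"
  by (induction n) (simp_all add: scaleC_one mult_scaleC_left mult_scaleC_right scaleC_scaleC mult.commute)

text \<open>Rickart's proof that a self-adjoint element of norm \<open>1\<close> has \<open>1\<close> or \<open>-1\<close> in its spectrum:
  averaging the resolvent \<open>(1 - z x)\<^sup>-\<^sup>1\<close> over roots of unity gives \<open>(1 - (z x)\<^sup>n)\<^sup>-\<^sup>1\<close>,
  so the latter family is equicontinuous up to the boundary of the disc. Doubling \<open>n\<close> is enough.\<close>
lemma unit_norm_sa_spectrum:
  fixes x :: "'a::unital_cstar_algebra"
  assumes x: "x\<^sup>\<star> = x" "norm x = 1"
    and inv: "invertible_in UNIV (x - 1)" "invertible_in UNIV (x + 1)"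
  shows False
proof -
  have "invertible_in UNIV (1 - z *\<^sub>C x)" if z: "cmod z \<le> 1" for z
  proof (cases "cmod z < 1")
    case True
    then show ?thesis using x by (intro neumann unital_subalgebra_UNIV) (auto simp: norm_scaleC)
  next
    case False
    with z have z1: "cmod z = 1" and z0: "z \<noteq> 0" by auto
    have eq: "1 - z *\<^sub>C x = (- z) *\<^sub>C (x - inverse z *\<^sub>C 1)"
      using z0 by (simp add: complex_vector.scale_right_diff_distrib scaleC_scaleC scaleC_one)
    have "invertible_in UNIV (x - inverse z *\<^sub>C 1)"
    proof (cases "Im (inverse z) = 0")
      case False
      then show ?thesis using x by (intro invertible_in_sa_nonreal unital_subalgebra_UNIV) auto
    next
      case True
      with z0 have "Im z = 0" by (auto simp: complex_eq_iff)
      with z1 have "z = 1 \<or> z = -1" by (auto simp: cmod_def complex_eq_iff)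
      then show ?thesis using inv by (auto simp: scaleC_one)
    qed
    then show ?thesis unfolding eq using z0 by (intro invertible_in_scaleC unital_subalgebra_UNIV) auto
  qed
  then have "\<forall>z. \<exists>b. cmod z \<le> 1 \<longrightarrow> b * (1 - z *\<^sub>C x) = 1 \<and> (1 - z *\<^sub>C x) * b = 1"
    by (auto simp: invertible_in_def)
  then obtain f where f: "\<And>z. cmod z \<le> 1 \<Longrightarrow> f z * (1 - z *\<^sub>C x) = 1"
      "\<And>z. cmod z \<le> 1 \<Longrightarrow> (1 - z *\<^sub>C x) * f z = 1"
    by metis
  have "continuous_on (cball 0 1) f"
    unfolding continuous_on_iff
  proof (intro ballI allI impI)
    fix z :: complex and e :: real assume z: "z \<in> cball 0 1" and e: "e > 0"
    define M where "M = 1 + norm (f z)"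
    have M: "M \<ge> 1" "norm (f z) \<le> M" by (auto simp: M_def)
    define d where "d = min (1 / (2 * M)) (e / (2 * M\<^sup>2))"
    have d0: "d > 0" using M e by (simp add: d_def)
    moreover have "dist (f w) (f z) < e" if w: "w \<in> cball 0 1" "dist w z < d" for w
    proof -
      have nw: "norm ((1 - w *\<^sub>C x) - (1 - z *\<^sub>C x)) = dist w z"
        using x by (simp add: dist_norm norm_minus_commute norm_scaleC
            flip: complex_vector.scale_left_diff_distrib)
      have "dist w z * norm (f z) \<le> d * M"
        using w M d0 by (intro mult_mono) auto
      also have "\<dots> \<le> (1 / (2 * M)) * M"
        using M by (intro mult_right_mono) (auto simp: d_def)
      also have "\<dots> = 1/2" using M by simp
      finally have "norm (f w - f z) \<le> 2 * (norm (f z))\<^sup>2 * dist w z"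
        using norm_inverse_diff [of "1 - z *\<^sub>C x" "f z" "f w" "1 - w *\<^sub>C x"] f z w
        unfolding nw by simp
      also have "\<dots> \<le> 2 * M\<^sup>2 * dist w z"
        using M by (intro mult_right_mono mult_left_mono power_mono) auto
      also have "\<dots> < 2 * M\<^sup>2 * d"
        using M w by (intro mult_strict_left_mono) auto
      also have "\<dots> \<le> 2 * M\<^sup>2 * (e / (2 * M\<^sup>2))"
        using M by (intro mult_left_mono) (auto simp: d_def)
      also have "\<dots> = e" using M by simp
      finally show ?thesis by (simp add: dist_norm)
    qed
    ultimately show "\<exists>d>0. \<forall>w\<in>cball 0 1. dist w z < d \<longrightarrow> dist (f w) (f z) < e" by blast
  qed
  then have "uniformly_continuous_on (cball 0 1) f"
    by (intro compact_uniformly_continuous) auto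
  then obtain d where d: "d > 0"
    "\<And>z w. \<lbrakk>z \<in> cball 0 1; w \<in> cball 0 1; dist w z < d\<rbrakk> \<Longrightarrow> dist (f w) (f z) < 1/4"
    unfolding uniformly_continuous_on_def by (metis zero_less_divide_1_iff zero_less_numeral)
  \<comment> \<open>\<open>r\<close> is below \<open>1\<close>, but so close that moving
    \<open>z\<close> to \<open>r z\<close> changes \<open>f\<close> by less than \<open>1/4\<close>.
    Averaging preserves this bound for all powers \<open>2 ^ k\<close>.\<close>
  define r where "r = max 0 (1 - d / 2)"
  have r: "0 \<le> r" "r < 1" "1 - r < d" using d(1) by (auto simp: r_def)
  have avg: "\<exists>g h. g * (1 - (z *\<^sub>C x) ^ (2 ^ k)) = 1 \<and> h * (1 - ((of_real r * z) *\<^sub>C x) ^ (2 ^ k)) = 1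
      \<and> norm (g - h) \<le> 1/4" if "cmod z \<le> 1" for z k
    using that
  proof (induction k arbitrary: z)
    case 0
    have 1: "cmod (of_real r * z) \<le> 1"
      using r 0 by (simp add: norm_mult mult_le_one)
    have "z - of_real r * z = of_real (1 - r) * z" by (simp add: algebra_simps)
    then have "dist z (of_real r * z) \<le> 1 - r"
      using r 0 by (simp add: dist_norm norm_mult mult_left_le del: of_real_diff)
    then have "dist (f z) (f (of_real r * z)) < 1/4"
      using r 0 1 by (intro d) auto
    with f [OF 0] f [OF 1] show ?case
      by (intro exI [of _ "f z"] exI [of _ "f (of_real r * z)"]) (simp add: dist_norm)
  next
    case (Suc k)
    define n :: nat where "n = 2 ^ k"
    \<comment> \<open>As \<open>\<zeta> ^ n = -1\<close>, replacing \<open>z\<close> by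
      \<open>\<zeta> * z\<close> turns \<open>1 - y ^ n\<close> into \<open>1 + y ^ n\<close> for
      \<open>y = z x\<close>; the mean of the two inverses inverts
      \<open>1 - y ^ (2 * n)\<close>.\<close>
    define \<zeta> where "\<zeta> = cis (pi / n)"
    have n: "n > 0" by (simp add: n_def)
    have "\<zeta> ^ n = cis pi" unfolding \<zeta>_def by (subst Complex.DeMoivre) (use n in simp)
    then have zn: "\<zeta> ^ n = -1" by simp
    have "cmod (\<zeta> * z) \<le> 1" using Suc.prems by (simp add: \<zeta>_def norm_mult)
    from Suc.IH [OF Suc.prems] Suc.IH [OF this] obtain g1 h1 g2 h2 where
      1: "g1 * (1 - (z *\<^sub>C x) ^ n) = 1" "h1 * (1 - ((of_real r * z) *\<^sub>C x) ^ n) = 1" and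
      2: "g2 * (1 - ((\<zeta> * z) *\<^sub>C x) ^ n) = 1" "h2 * (1 - ((of_real r * (\<zeta> * z)) *\<^sub>C x) ^ n) = 1" and
      3: "norm (g1 - h1) \<le> 1/4" "norm (g2 - h2) \<le> 1/4"
      unfolding n_def by blast
    have 2: "g2 * (1 + (z *\<^sub>C x) ^ n) = 1" "h2 * (1 + ((of_real r * z) *\<^sub>C x) ^ n) = 1"
      using 2 by (simp_all add: scaleC_power power_mult_distrib zn)
    have comb: "((1/2) *\<^sub>R (u + v)) * (1 - y ^ (2 * n)) = 1"
      if "u * (1 - y ^ n) = 1" "v * (1 + y ^ n) = 1" for u v y :: 'a
    proof -
      have "1 - y ^ (2 * n) = (1 - y ^ n) * (1 + y ^ n)" "1 - y ^ (2 * n) = (1 + y ^ n) * (1 - y ^ n)"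
        by (simp_all add: algebra_simps flip: power_add mult_2)
      then have "u * (1 - y ^ (2 * n)) = 1 + y ^ n" "v * (1 - y ^ (2 * n)) = 1 - y ^ n"
        using that by (metis mult.assoc mult_1_left)+
      then show ?thesis by (simp add: distrib_right flip: scaleR_2)
    qed
    have "norm ((1/2) *\<^sub>R (g1 + g2) - (1/2) *\<^sub>R (h1 + h2)) = norm ((1/2) *\<^sub>R ((g1 - h1) + (g2 - h2)))"
      by (simp add: algebra_simps)
    also have "\<dots> \<le> 1/4"
      using 3 norm_triangle_ineq [of "g1 - h1" "g2 - h2"] by simp
    finally show ?case
      using comb [OF 1(1) 2(1)] comb [OF 1(2) 2(2)] unfolding n_def power_Suc [symmetric] by blast
  qed
  have nx: "norm (x ^ (2 ^ k)) = 1" for k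
  proof (induction k)
    case (Suc k)
    have "x ^ 2 ^ Suc k = x ^ (2 ^ k) * x ^ (2 ^ k)"
      by (simp flip: power_add mult_2)
    then show ?case using norm_sa_square [of "x ^ (2 ^ k)"] Suc x by (simp add: star_power)
  qed (use x in simp)
  \<comment> \<open>The bound \<open>1/7\<close> puts \<open>h\<close> within \<open>1/6\<close> of
    \<open>1\<close>, hence \<open>g\<close> within \<open>1/6 + 1/4 < 0.42\<close>. Then
    \<open>x ^ n = (g - 1) * (1 - x ^ n)\<close> has norm at most \<open>0.84\<close>, although its
    norm is \<open>1\<close>.\<close>
  obtain m where m: "r ^ m < 1/7"
    using real_arch_pow_inv [of "1/7" r] r by auto
  define n :: nat where "n = 2 ^ m"
  have "m \<le> n" unfolding n_def using less_exp [of m] by simp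
  then have rn: "r ^ n \<le> 1/7" using m r power_decreasing [of m n r] by simp
  obtain g h where g: "g * (1 - x ^ n) = 1" and h: "h * (1 - (of_real r *\<^sub>C x) ^ n) = 1"
    and gh: "norm (g - h) \<le> 1/4"
    using avg [of 1 m] by (auto simp: n_def scaleC_one)
  define y where "y = (of_real r *\<^sub>C x) ^ n"
  have y: "norm y \<le> 1/7"
    using rn r nx [of m] by (simp add: y_def scaleC_power norm_scaleC n_def norm_power)
  have hy: "h - 1 = h * y" using h by (simp add: y_def algebra_simps)
  have "norm (h - 1) \<le> norm h * (1/7)"
    unfolding hy using y by (meson mult_left_mono norm_ge_zero norm_mult_ineq order_trans)
  moreover have "norm h \<le> 1 + norm (h - 1)"
    using norm_triangle_sub [of h 1] by simp
  ultimately have "norm (h - 1) \<le> 1/6" by simp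
  then have "norm (g - 1) \<le> 2/5 + 1/50"
    using gh norm_triangle_ineq [of "g - h" "h - 1"] by simp
  moreover have "x ^ n = (g - 1) * (1 - x ^ n)"
    using g by (simp add: algebra_simps)
  then have "norm (x ^ n) \<le> norm (g - 1) * norm (1 - x ^ n)"
    by (metis norm_mult_ineq)
  moreover have "norm (1 - x ^ n) \<le> 2"
    using norm_triangle_ineq4 [of 1 "x ^ n"] nx [of m] by (simp add: n_def)
  then have "norm (g - 1) * norm (1 - x ^ n) \<le> norm (g - 1) * 2"
    by (intro mult_left_mono) auto
  ultimately show False using nx [of m] by (simp add: n_def)
qed

lemma sa_spectrum_norm:
  fixes a :: "'a::unital_cstar_algebra"
  assumes a: "a\<^sup>\<star> = a" "a \<noteq> 0"
    and inv: "invertible_in UNIV (a - of_real (norm a))" "invertible_in UNIV (a + of_real (norm a))"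
  shows False
proof (rule unit_norm_sa_spectrum)
  define z where "z = complex_of_real (inverse (norm a))"
  have z: "z \<noteq> 0" "z * complex_of_real (norm a) = 1" using a by (simp_all add: z_def flip: of_real_mult)
  show "(z *\<^sub>C a)\<^sup>\<star> = z *\<^sub>C a" using a by (simp add: star_scaleC z_def)
  show "norm (z *\<^sub>C a) = 1" using a by (simp add: norm_scaleC z_def norm_inverse)
  have "z *\<^sub>C of_real (norm a) = (1::'a)"
    using z by (simp add: of_real_eq_scaleC scaleC_scaleC scaleC_one)
  then have "z *\<^sub>C a - 1 = z *\<^sub>C (a - of_real (norm a))" "z *\<^sub>C a + 1 = z *\<^sub>C (a + of_real (norm a))"
    by (simp_all add: complex_vector.scale_right_diff_distrib scaleC_add_right)
  then show "invertible_in UNIV (z *\<^sub>C a - 1)" "invertible_in UNIV (z *\<^sub>C a + 1)"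
    using invertible_in_scaleC [OF unital_subalgebra_UNIV _ z(1)] inv by simp_all
qed

section \<open>The cone described by norm inequalities\<close>

abbreviation Pos :: "'a::unital_cstar_algebra set" where
  "Pos \<equiv> positives UNIV"

lemma pos_sa: "a \<in> Pos \<Longrightarrow> a\<^sup>\<star> = a"
  by (simp add: positives_def)

lemma invertible_in_minus:
  assumes "unital_subalgebra D" "invertible_in D (- a)" shows "invertible_in D a"
  using invertible_in_scaleC [OF assms, of "-1"] by (simp add: scaleC_one)

text \<open>Together with the converse \<open>norm_le_if_pos\<close>, this makes closure under sums
  a triangle inequality.\<close>

lemma pos_if_norm_le:
  assumes "a\<^sup>\<star> = a" and "norm (of_real t - a) \<le> t"
  shows "a \<in> Pos"
  unfolding positives_iff
proof (intro conjI allI impI assms)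
  fix s :: real assume s: "s > 0"
  have t: "t \<ge> 0" using assms(2) norm_ge_zero order_trans by blast
  have "invertible_in UNIV (of_real t - a - complex_of_real (t + s) *\<^sub>C 1)"
    using s t assms(2) by (intro invertible_in_minus_scalar unital_subalgebra_UNIV) (auto simp del: of_real_add)
  moreover have "of_real t - a - complex_of_real (t + s) *\<^sub>C 1 = - (a + of_real s)"
    by (simp add: of_real_eq_scaleC scaleC_add_left)
  ultimately show "invertible_in UNIV (a + of_real s)"
    using invertible_in_minus unital_subalgebra_UNIV by metis
qed

text \<open>If \<open>y = t - a\<close> had norm \<open>R > t\<close>, then \<open>y - R\<close>
  would be invertible by positivity of \<open>a\<close> and \<open>y + R\<close> because
  \<open>norm a < t + R\<close>, contradicting \<open>sa_spectrum_norm\<close>.\<close>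

lemma norm_le_if_pos:
  assumes a: "a \<in> Pos" and t: "norm a \<le> t"
  shows "norm (of_real t - a) \<le> t"
proof (rule ccontr)
  define y where "y = of_real t - a"
  define R where "R = norm y"
  assume "\<not> ?thesis"
  then have R: "R > t" by (simp add: y_def R_def)
  have t0: "t \<ge> 0" using t norm_ge_zero order_trans by blast
  have "invertible_in UNIV (a + of_real (R - t))"
    using a R by (metis diff_gt_0_iff_gt positives_iff)
  moreover have "a + of_real (R - t) = - (y - of_real R)" by (simp add: y_def)
  ultimately have 1: "invertible_in UNIV (y - of_real R)"
    using invertible_in_minus unital_subalgebra_UNIV by metis
  have "invertible_in UNIV (a - complex_of_real (t + R) *\<^sub>C 1)"
    using R t t0 by (intro invertible_in_minus_scalar unital_subalgebra_UNIV) (auto simp del: of_real_add)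
  moreover have "a - complex_of_real (t + R) *\<^sub>C 1 = - (y + of_real R)"
    by (simp add: y_def of_real_eq_scaleC scaleC_add_left)
  ultimately have 2: "invertible_in UNIV (y + of_real R)"
    using invertible_in_minus unital_subalgebra_UNIV by metis
  show False
  proof (rule sa_spectrum_norm)
    show "y\<^sup>\<star> = y" using pos_sa [OF a] by (simp add: y_def star_simps)
    show "y \<noteq> 0" using R t0 by (auto simp: R_def)
  qed (use 1 2 in \<open>simp_all add: R_def\<close>)
qed

lemma pos_add: "a \<in> Pos \<Longrightarrow> b \<in> Pos \<Longrightarrow> a + b \<in> Pos"
  using norm_le_if_pos [of a "norm a"] norm_le_if_pos [of b "norm b"]
    norm_triangle_ineq [of "of_real (norm a) - a" "of_real (norm b) - b"]
  by (intro pos_if_norm_le [where t = "norm a + norm b"]) (simp_all add: star_simps pos_sa algebra_simps)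

lemma pos_scaleR:
  assumes a: "a \<in> Pos" and r: "r \<ge> 0"
  shows "r *\<^sub>R a \<in> Pos"
proof (rule pos_if_norm_le)
  show "(r *\<^sub>R a)\<^sup>\<star> = r *\<^sub>R a" using a by (simp add: star_simps pos_sa)
  have "of_real (r * norm a) - r *\<^sub>R a = r *\<^sub>R (of_real (norm a) - a)"
    by (simp add: of_real_def scaleR_right_diff_distrib)
  then show "norm (of_real (r * norm a) - r *\<^sub>R a) \<le> r * norm a"
    using norm_le_if_pos [OF a order_refl] r by (simp add: mult_left_mono)
qed

lemma sa_le_norm:
  assumes "a\<^sup>\<star> = a" "norm a \<le> t"
  shows "of_real t - a \<in> Pos" "of_real t + a \<in> Pos"
  using assms by (auto intro!: pos_if_norm_le [where t = t] simp: star_simps)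

lemma pos_of_real: "t \<ge> 0 \<Longrightarrow> of_real t \<in> (Pos :: 'a::unital_cstar_algebra set)"
  using sa_le_norm(1) [of 0 t] by simp

lemma pos_one [simp]: "1 \<in> (Pos :: 'a::unital_cstar_algebra set)"
  using pos_of_real [of 1] by simp

text \<open>If \<open>norm a > t\<close>, positivity of \<open>t - a\<close> excludes
  \<open>norm a\<close> from the spectrum of \<open>a\<close>, and positivity of \<open>a\<close>
  excludes \<open>- norm a\<close>.\<close>

lemma pos_norm_le:
  assumes a: "a \<in> Pos" and b: "of_real t - a \<in> Pos" and t: "t \<ge> 0"
  shows "norm a \<le> t"
proof (rule ccontr)
  assume "\<not> ?thesis"
  then have R: "norm a > t" by simp
  have "invertible_in UNIV (of_real t - a + of_real (norm a - t))"
    using b R by (metis diff_gt_0_iff_gt positives_iff)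
  moreover have "of_real t - a + of_real (norm a - t) = - (a - of_real (norm a))" by simp
  ultimately have "invertible_in UNIV (a - of_real (norm a))"
    using invertible_in_minus unital_subalgebra_UNIV by metis
  moreover have "invertible_in UNIV (a + of_real (norm a))"
    using a R t positives_iff order_le_less_trans by blast
  ultimately show False using sa_spectrum_norm [of a] R t pos_sa [OF a] by fastforce
qed

lemma pos_antisym: "a \<in> Pos \<Longrightarrow> - a \<in> Pos \<Longrightarrow> a = 0"
  using pos_norm_le [of a 0] by simp

text \<open>\<open>a^2 + t\<close> factors as \<open>(a - i sqrt t) (a + i sqrt t)\<close>, and both
  factors are shifts by non-real scalars.\<close>

lemma pos_square:
  assumes a: "a\<^sup>\<star> = a"
  shows "a * a \<in> Pos"
  unfolding positives_iff
proof (intro conjI allI impI)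
  show "(a * a)\<^sup>\<star> = a * a" using a by (simp add: star_simps)
  fix t :: real assume t: "t > 0"
  define z where "z = \<i> * complex_of_real (sqrt t)"
  have z: "Im z \<noteq> 0" "Im (- z) \<noteq> 0" using t by (auto simp: z_def)
  have zz: "z * z = - of_real t"
    using t by (simp add: z_def power_mult_distrib flip: of_real_power power2_eq_square)
  have "invertible_in UNIV ((a - z *\<^sub>C 1) * (a - (- z) *\<^sub>C 1))"
    using a z by (intro invertible_in_mult invertible_in_sa_nonreal unital_subalgebra_UNIV) auto
  moreover have "(a - z *\<^sub>C 1) * (a - (- z) *\<^sub>C 1) = a * a + of_real t"
    by (simp add: algebra_simps mult_scaleC_left mult_scaleC_right scaleC_scaleC zz of_real_eq_scaleC)
  ultimately show "invertible_in UNIV (a * a + of_real t)" by simp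
qed

section \<open>Square roots and positivity of \<open>x\<^sup>\<star> x\<close>\<close>

text \<open>With \<open>a = 1 - y\<close>, the square root is \<open>1 - r\<close> for the solution \<open>r\<close> of \<open>r = (y + r\<^sup>2) / 2\<close>;
  the iteration is dominated by the scalar one for \<open>y = 1\<close>.\<close>
lemma pos_sqrt_contraction:
  fixes D :: "'a::unital_cstar_algebra set"
  assumes D: "unital_subalgebra D" and a: "a \<in> Pos" "a \<in> D" and na: "norm a \<le> 1"
  obtains s where "s \<in> Pos" "s \<in> D" "s * s = a" "\<And>c. c * a = a * c \<Longrightarrow> c * s = s * c"
proof -
  define y where "y = 1 - a"
  have y: "norm y \<le> 1" "y \<in> D" "y\<^sup>\<star> = y"
    using norm_le_if_pos [OF a(1) na] a D by (auto simp: y_def star_simps pos_sa intro!: sub_intros)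
  define r where "r = rec_nat 0 (\<lambda>_ u. (1/2) *\<^sub>R (y + u * u))"
  define \<rho> :: "nat \<Rightarrow> real" where "\<rho> = rec_nat 0 (\<lambda>_ u. (1 + u * u) / 2)"
  have r: "r 0 = 0" "r (Suc n) = (1/2) *\<^sub>R (y + r n * r n)" for n
    by (simp_all add: r_def)
  have \<rho>: "\<rho> 0 = 0" "\<rho> (Suc n) = (1 + \<rho> n * \<rho> n) / 2" for n
    by (simp_all add: \<rho>_def)
  have \<rho>01: "0 \<le> \<rho> n \<and> \<rho> n \<le> 1" for n
    by (induction n) (auto simp: \<rho> mult_le_one)
  have nr: "norm (r n) \<le> \<rho> n" for n
  proof (induction n)
    case (Suc n)
    have "norm (r n * r n) \<le> \<rho> n * \<rho> n"
      using Suc \<rho>01 [of n] by (meson mult_mono norm_ge_zero norm_mult_ineq order_trans)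
    then show ?case using y norm_triangle_ineq [of y "r n * r n"] by (simp add: r \<rho>)
  qed (simp add: r \<rho>)
  have dr: "norm (r (Suc n) - r n) \<le> \<rho> (Suc n) - \<rho> n" for n
  proof (induction n)
    case 0
    then show ?case using y by (simp add: r \<rho>)
  next
    case (Suc n)
    define d where "d = r (Suc n) - r n"
    have "r (Suc (Suc n)) - r (Suc n) = (1/2) *\<^sub>R (d * r (Suc n) + r n * d)"
      unfolding r(2) [of "Suc n"] by (subst (3) r(2)) (simp add: d_def algebra_simps)
    moreover have "norm (d * r (Suc n)) \<le> (\<rho> (Suc n) - \<rho> n) * \<rho> (Suc n)"
      "norm (r n * d) \<le> \<rho> n * (\<rho> (Suc n) - \<rho> n)"
      using Suc nr \<rho>01 [of n] \<rho>01 [of "Suc n"] unfolding d_def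
      by (meson mult_mono norm_ge_zero norm_mult_ineq order_trans)+
    ultimately have "norm (r (Suc (Suc n)) - r (Suc n)) \<le>
        ((\<rho> (Suc n) - \<rho> n) * \<rho> (Suc n) + \<rho> n * (\<rho> (Suc n) - \<rho> n)) / 2"
      using norm_triangle_ineq [of "d * r (Suc n)" "r n * d"] by simp
    also have "\<dots> = \<rho> (Suc (Suc n)) - \<rho> (Suc n)"
      unfolding \<rho>(2) [of "Suc n"] by (subst (6) \<rho>(2)) (simp add: field_simps)
    finally show ?case .
  qed
  have "incseq \<rho>" using dr by (intro incseq_SucI) (meson diff_ge_0_iff_ge norm_ge_zero order_trans)
  then have "convergent \<rho>"
    using \<rho>01 incseq_convergent [of \<rho> 1] by (metis convergentI)
  then have "summable (\<lambda>n. \<rho> (Suc n) - \<rho> n)"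
    by (auto simp: convergent_def intro: telescope_summable)
  then have "summable (\<lambda>n. r (Suc n) - r n)"
    by (rule summable_comparison_test' [where N = 0]) (rule dr)
  then have "(\<lambda>n. \<Sum>i<n. r (Suc i) - r i) \<longlonglongrightarrow> (\<Sum>n. r (Suc n) - r n)"
    by (rule summable_LIMSEQ)
  then obtain l where l: "r \<longlonglongrightarrow> l"
    by (auto simp: sum_lessThan_telescope r(1) simp del: r(2))
  have "(\<lambda>n. r (Suc n)) \<longlonglongrightarrow> (1/2) *\<^sub>R (y + l * l)"
    unfolding r(2) by (intro tendsto_intros l)
  then have l_eq: "l = (1/2) *\<^sub>R (y + l * l)"
    using LIMSEQ_Suc [OF l] LIMSEQ_unique by blast
  have "(\<lambda>n. norm (r n)) \<longlonglongrightarrow> norm l" by (intro tendsto_intros l)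
  then have nl: "norm l \<le> 1"
    by (rule LIMSEQ_le_const2) (use nr \<rho>01 order_trans in blast)
  have rD: "r n \<in> D" and rs: "(r n)\<^sup>\<star> = r n" for n
    using D y by (induction n) (auto simp: r star_simps intro!: sub_intros)
  have lD: "l \<in> D" using rD l by (rule sub_limit [OF D])
  have "(\<lambda>n. (r n)\<^sup>\<star>) \<longlonglongrightarrow> l\<^sup>\<star>" by (intro tendsto_intros l)
  then have ls: "l\<^sup>\<star> = l" using l LIMSEQ_unique unfolding rs by blast
  show thesis
  proof
    show "1 - l \<in> Pos"
      using ls nl by (intro pos_if_norm_le [where t = 1]) (auto simp: star_simps)
    show "1 - l \<in> D" using lD D by (auto intro!: sub_intros)
    have "2 *\<^sub>R l = y + l * l" by (subst l_eq) simp
    then show "(1 - l) * (1 - l) = a" by (simp add: y_def algebra_simps scaleR_2)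
    fix c assume c: "c * a = a * c"
    have "c * r n = r n * c" for n
    proof (induction n)
      case (Suc n)
      have "c * (r n * r n) = r n * r n * c" using Suc by (metis mult.assoc)
      then show ?case using c by (simp add: r y_def algebra_simps)
    qed (simp add: r)
    then have "(\<lambda>n. c * r n) \<longlonglongrightarrow> l * c" using tendsto_mult_right [OF l, of c] by simp
    then have "c * l = l * c" using tendsto_mult_left [OF l, of c] LIMSEQ_unique by blast
    then show "c * (1 - l) = (1 - l) * c" by (simp add: algebra_simps)
  qed
qed

lemma pos_sqrt:
  fixes D :: "'a::unital_cstar_algebra set"
  assumes D: "unital_subalgebra D" and a: "a \<in> Pos" "a \<in> D"
  obtains s where "s \<in> Pos" "s \<in> D" "s * s = a" "\<And>c. c * a = a * c \<Longrightarrow> c * s = s * c"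
proof -
  define t where "t = 1 + norm a"
  have t: "t > 0" "norm a \<le> t" by (simp_all add: t_def add_pos_nonneg)
  have "inverse t *\<^sub>R a \<in> Pos" "inverse t *\<^sub>R a \<in> D" "norm (inverse t *\<^sub>R a) \<le> 1"
    using a t sub_scaleR [OF D] by (auto intro!: pos_scaleR simp: field_simps)
  from pos_sqrt_contraction [OF D this] obtain s where s: "s \<in> Pos" "s \<in> D"
    "s * s = inverse t *\<^sub>R a" "\<And>c. c * (inverse t *\<^sub>R a) = inverse t *\<^sub>R a * c \<Longrightarrow> c * s = s * c"
    by blast
  show thesis
  proof
    show "sqrt t *\<^sub>R s \<in> Pos" "sqrt t *\<^sub>R s \<in> D"
      using s(1,2) t sub_scaleR [OF D] by (auto intro!: pos_scaleR)
    show "sqrt t *\<^sub>R s * (sqrt t *\<^sub>R s) = a" using s(3) t by (simp flip: mult.assoc)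
    show "c * sqrt t *\<^sub>R s = sqrt t *\<^sub>R s * c" if "c * a = a * c" for c
      using s(4) [of c] that by simp
  qed
qed

text \<open>The commutation clause of \<open>pos_sqrt\<close>, used twice, gives commuting roots
  \<open>s\<close> and \<open>t\<close>, and \<open>x y\<close> is the square of the self-adjoint
  \<open>s t\<close>.\<close>

lemma pos_mult_commute:
  assumes "x \<in> Pos" "y \<in> Pos" "x * y = y * x"
  shows "x * y \<in> Pos"
proof -
  obtain s where s: "s \<in> Pos" "s * s = x" "\<And>c. c * x = x * c \<Longrightarrow> c * s = s * c"
    using pos_sqrt [OF unital_subalgebra_UNIV assms(1) UNIV_I] by metis
  obtain t where t: "t \<in> Pos" "t * t = y" "\<And>c. c * y = y * c \<Longrightarrow> c * t = t * c"
    using pos_sqrt [OF unital_subalgebra_UNIV assms(2) UNIV_I] by metis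
  have "s * y = y * s" using s(3) assms(3) by simp
  then have st: "s * t = t * s" by (rule t(3))
  then have "(s * t)\<^sup>\<star> = s * t" using s(1) t(1) by (simp add: star_simps pos_sa)
  then have "s * t * (s * t) \<in> Pos" by (rule pos_square)
  moreover have "s * t * (s * t) = x * y" using st s(2) t(2) by (metis mult.assoc)
  ultimately show ?thesis by simp
qed

lemma sa_abs:
  fixes D :: "'a::unital_cstar_algebra set"
  assumes D: "unital_subalgebra D" and a: "a \<in> D" "a\<^sup>\<star> = a"
  obtains m where "m \<in> Pos" "m \<in> D" "m * m = a * a" "a * m = m * a"
  using pos_sqrt [OF D pos_square [OF a(2)]] sub_mult [OF D a(1) a(1)] mult.assoc by metis

text \<open>\<open>P\<close> and \<open>N\<close> are the positive and negative part of \<open>a\<close>. Their own positivity is never needed,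
  since they only enter through their squares and through \<open>P a P\<close>.\<close>
lemma sa_parts:
  fixes D :: "'a::unital_cstar_algebra set"
  assumes D: "unital_subalgebra D" and a: "a \<in> D" "a\<^sup>\<star> = a"
  obtains P N where "P \<in> D" "N \<in> D" "P\<^sup>\<star> = P" "N\<^sup>\<star> = N" "P * N = 0" "N * P = 0"
    "P * a = P * P" "N * a = - (N * N)"
    "P * a * P \<in> Pos" "- (N * a * N) \<in> Pos"
    "P = 0 \<Longrightarrow> - a \<in> Pos" "N = 0 \<Longrightarrow> a \<in> Pos"
proof -
  obtain m where m: "m \<in> Pos" "m \<in> D" "m * m = a * a" "a * m = m * a"
    using sa_abs [OF D a] by blast
  define P where "P = (1/2) *\<^sub>R (m + a)"
  define N where "N = (1/2) *\<^sub>R (m - a)"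
  have PN: "P * N = 0" "N * P = 0"
    using m by (simp_all add: P_def N_def algebra_simps)
  have a_eq: "a = P - N" and m_eq: "m = P + N"
    by (simp_all add: P_def N_def algebra_simps flip: scaleR_left_distrib)
  have Pm: "P * m = P * P" "m * P = P * P" "N * m = N * N" "m * N = N * N"
    by (simp_all add: m_eq PN algebra_simps)
  have Pa: "P * a = P * P" "N * a = - (N * N)"
    by (simp_all add: a_eq PN algebra_simps)
  have s: "P\<^sup>\<star> = P" "N\<^sup>\<star> = N"
    using a m by (simp_all add: P_def N_def star_simps pos_sa)
  have D': "P \<in> D" "N \<in> D" unfolding P_def N_def using D a m by (auto intro!: sub_intros)
  \<comment> \<open>\<open>P a P\<close> equals \<open>P^2 m\<close> and \<open>- (N a N)\<close>
    equals \<open>N^2 m\<close>: products of commuting positive elements.\<close>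
  have "P * P * m = m * (P * P)" "N * N * m = m * (N * N)"
    using Pm by (metis mult.assoc)+
  then have "(P * P) * m \<in> Pos" "(N * N) * m \<in> Pos"
    using s m(1) by (simp_all only: pos_mult_commute pos_square)
  then have "P * a * P \<in> Pos" "- (N * a * N) \<in> Pos"
    by (simp_all add: Pa mult.assoc Pm)
  moreover have "P = 0 \<Longrightarrow> - a \<in> Pos" "N = 0 \<Longrightarrow> a \<in> Pos" using a_eq m_eq m(1) by auto
  ultimately show thesis using that D' s PN Pa by blast
qed

text \<open>If \<open>k\<close> inverts \<open>t - y\<^sup>\<star> y\<close>, then
  \<open>(1 + y k y\<^sup>\<star>) / t\<close> inverts \<open>t - y y\<^sup>\<star>\<close>: the two
  products have the same spectrum away from \<open>0\<close>.\<close>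

lemma neg_star_mult_swap:
  assumes "- (y\<^sup>\<star> * y) \<in> Pos"
  shows "- (y * y\<^sup>\<star>) \<in> Pos"
  unfolding positives_iff
proof (intro conjI allI impI)
  show "(- (y * y\<^sup>\<star>))\<^sup>\<star> = - (y * y\<^sup>\<star>)" by (simp add: star_simps)
  fix t :: real assume t: "t > 0"
  then have "invertible_in UNIV (- (y\<^sup>\<star> * y) + of_real t)"
    using assms by (simp add: positives_iff)
  then obtain k where k: "k * (of_real t - y\<^sup>\<star> * y) = 1" "(of_real t - y\<^sup>\<star> * y) * k = 1"
    by (auto simp: invertible_in_def)
  have k1: "k * (y\<^sup>\<star> * y) = t *\<^sub>R k - 1" and k2: "y\<^sup>\<star> * y * k = t *\<^sub>R k - 1"
    using k by (simp_all add: algebra_simps of_real_def)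
  define w where "w = y * k * y\<^sup>\<star>"
  have "w * (y * y\<^sup>\<star>) = y * (k * (y\<^sup>\<star> * y)) * y\<^sup>\<star>" "y * y\<^sup>\<star> * w = y * (y\<^sup>\<star> * y * k) * y\<^sup>\<star>"
    by (simp_all only: w_def mult.assoc)
  then have w: "w * (y * y\<^sup>\<star>) = t *\<^sub>R w - y * y\<^sup>\<star>" "y * y\<^sup>\<star> * w = t *\<^sub>R w - y * y\<^sup>\<star>"
    unfolding k1 k2 by (simp_all add: w_def algebra_simps)
  have "(1 + w) * (- (y * y\<^sup>\<star>) + of_real t) = t *\<^sub>R 1" "(- (y * y\<^sup>\<star>) + of_real t) * (1 + w) = t *\<^sub>R 1"
    by (simp_all add: algebra_simps w [unfolded mult.assoc] of_real_def)
  then show "invertible_in UNIV (- (y * y\<^sup>\<star>) + of_real t)"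
    using t unfolding invertible_in_def by (intro bexI [of _ "inverse t *\<^sub>R (1 + w)"]) simp_all
qed

text \<open>\<open>y\<^sup>\<star> y + y y\<^sup>\<star>\<close> is half a sum of two self-adjoint
  squares, hence positive. Adding the positive \<open>- (y y\<^sup>\<star>)\<close> shows that
  \<open>y\<^sup>\<star> y\<close> is positive as well as negative.\<close>

lemma star_mult_neg_imp_zero:
  assumes "- (y\<^sup>\<star> * y) \<in> Pos"
  shows "y = (0::'a::unital_cstar_algebra)"
proof -
  define p where "p = y + y\<^sup>\<star>"
  define q where "q = \<i> *\<^sub>C (y - y\<^sup>\<star>)"
  have "p * p + q * q = 2 *\<^sub>R (y\<^sup>\<star> * y + y * y\<^sup>\<star>)"
    by (simp add: p_def q_def mult_scaleC_left mult_scaleC_right scaleC_scaleC algebra_simps scaleR_2)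
  moreover have "p\<^sup>\<star> = p" "q\<^sup>\<star> = q"
    by (simp_all add: p_def q_def star_simps star_scaleC algebra_simps)
  ultimately have "2 *\<^sub>R (y\<^sup>\<star> * y + y * y\<^sup>\<star>) \<in> Pos"
    by (metis pos_add pos_square)
  then have "(1/2) *\<^sub>R 2 *\<^sub>R (y\<^sup>\<star> * y + y * y\<^sup>\<star>) \<in> Pos" by (rule pos_scaleR) simp
  then have "y\<^sup>\<star> * y + y * y\<^sup>\<star> \<in> Pos" by simp
  from pos_add [OF this neg_star_mult_swap [OF assms]] have "y\<^sup>\<star> * y \<in> Pos" by simp
  then have "y\<^sup>\<star> * y = 0" using assms by (intro pos_antisym) auto
  then show ?thesis using norm_star_mult [of y] by simp
qed

text \<open>With \<open>N\<close> the negative part of \<open>a = x\<^sup>\<star> x\<close>, the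
  element \<open>x N\<close> satisfies the previous lemma, so \<open>x N = 0\<close>; then
  \<open>a N = 0\<close> and \<open>N^2 = - N a = 0\<close>.\<close>

lemma pos_star_mult: "x\<^sup>\<star> * x \<in> (Pos :: 'a::unital_cstar_algebra set)"
proof -
  define a where "a = x\<^sup>\<star> * x"
  have a: "a\<^sup>\<star> = a" by (simp add: a_def star_simps)
  obtain P N where PN: "N\<^sup>\<star> = N" "N * a = - (N * N)" "- (N * a * N) \<in> Pos" "N = 0 \<Longrightarrow> a \<in> Pos"
    using sa_parts [OF unital_subalgebra_UNIV _ a] by (metis UNIV_I)
  have "(x * N)\<^sup>\<star> * (x * N) = N * a * N" using PN(1) by (simp add: a_def star_simps mult.assoc)
  then have "x * N = 0" using PN(3) by (intro star_mult_neg_imp_zero) (simp only:)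
  then have "a * N = 0" by (simp add: a_def mult.assoc)
  then have "N * N = 0" using PN a star_mult [of a N] by simp
  then have "N = 0" using norm_sa_square [OF PN(1)] by simp
  with PN show ?thesis by (simp add: a_def)
qed

lemma pos_conj:
  assumes "c \<in> Pos" shows "x\<^sup>\<star> * c * x \<in> Pos"
proof -
  obtain s where s: "s \<in> Pos" "s * s = c"
    using pos_sqrt [OF unital_subalgebra_UNIV assms UNIV_I] by metis
  then have "x\<^sup>\<star> * c * x = (s * x)\<^sup>\<star> * (s * x)" by (simp add: star_simps pos_sa mult.assoc flip: s(2))
  then show ?thesis by (simp add: pos_star_mult)
qed

lemma pos_conj': "c \<in> Pos \<Longrightarrow> x * c * x\<^sup>\<star> \<in> Pos"
  using pos_conj [of c "x\<^sup>\<star>"] by (simp add: star_star)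

lemma star_mult_le_norm: "of_real ((norm x)\<^sup>2) - x\<^sup>\<star> * x \<in> Pos"
  by (intro sa_le_norm) (simp_all add: star_simps norm_star_mult)

lemma invertible_in_if_ge:
  assumes D: "unital_subalgebra D" and a: "a \<in> D" "a - of_real \<delta> \<in> Pos" and "\<delta> > 0"
  shows "invertible_in D a"
proof (rule invertible_in_sa_permanence [OF D a(1)])
  have "(a - of_real \<delta>)\<^sup>\<star> = a - of_real \<delta>" using a(2) by (rule pos_sa)
  then show "a\<^sup>\<star> = a" by (simp add: star_simps)
  have "invertible_in UNIV (a - of_real \<delta> + of_real \<delta>)"
    using a(2) assms(4) unfolding positives_iff by blast
  then show "invertible_in UNIV a" by simp
qed

text \<open>The inverse square root of \<open>y\<^sup>\<star> c y\<close> normalises it to \<open>1\<close>.\<close>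
lemma conj_one_if_ge:
  assumes D: "unital_subalgebra D" and y: "y \<in> D" "c \<in> D"
    and ge: "y\<^sup>\<star> * c * y - of_real \<delta> \<in> Pos" and \<delta>: "\<delta> > 0"
  obtains v where "v \<in> D" "v * c * v\<^sup>\<star> = 1"
proof -
  define z where "z = y\<^sup>\<star> * c * y"
  have zD: "z \<in> D" unfolding z_def using D y by (intro sub_intros)
  then have "invertible_in D z" using ge \<delta> unfolding z_def by (rule invertible_in_if_ge [OF D])
  then obtain k where k: "k \<in> D" "k * z = 1" "z * k = 1" by (auto simp: invertible_in_def)
  have "z - of_real \<delta> + of_real \<delta> \<in> Pos"
    using ge \<delta> unfolding z_def by (intro pos_add pos_of_real) auto
  then have z: "z \<in> Pos" by simp
  have "k\<^sup>\<star> * z = 1" using k(3) pos_sa [OF z] by (metis star_mult star_one)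
  then have ks: "k\<^sup>\<star> = k" using k by (metis mult.assoc mult_1_left mult_1_right)
  have "k\<^sup>\<star> * z * k \<in> Pos" using z by (rule pos_conj)
  then have "k \<in> Pos" by (simp add: k ks)
  then obtain r where r: "r \<in> Pos" "r \<in> D" "r * r = k" "\<And>c. c * k = k * c \<Longrightarrow> c * r = r * c"
    using pos_sqrt [OF D _ k(1)] by metis
  have "z * r = r * z" using r(4) k by simp
  then have "r * z * r = 1" using k(3) r(3) by (metis mult.assoc)
  then have "(r * y\<^sup>\<star>) * c * (r * y\<^sup>\<star>)\<^sup>\<star> = 1"
    using r(1) by (simp add: z_def star_simps pos_sa mult.assoc)
  moreover have "r * y\<^sup>\<star> \<in> D" using r(2) y(1) by (intro sub_mult [OF D] sub_star [OF D])
  ultimately show thesis using that by blast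
qed

text \<open>\<open>1 = y\<^sup>\<star> c x\<^sup>\<star> x c y\<close> is at most
  \<open>(norm x)^2\<close> times \<open>y\<^sup>\<star> c^2 y\<close>, and \<open>c^2\<close> is at
  most \<open>norm c\<close> times \<open>c\<close>. So \<open>y\<^sup>\<star> c y\<close> is
  bounded below by \<open>inverse K\<close>.\<close>

lemma conj_one_if_mult_one:
  assumes D: "unital_subalgebra D" and c: "c \<in> D" "c \<in> Pos" and xy: "x \<in> D" "y \<in> D"
    and eq: "x * c * y = 1"
  obtains v where "v \<in> D" "v * c * v\<^sup>\<star> = 1"
proof (rule conj_one_if_ge [OF D xy(2) c(1)])
  define K where "K = (norm x)\<^sup>2 * norm c"
  have cs: "c\<^sup>\<star> = c" using c by (simp add: pos_sa)
  have "x \<noteq> 0" "c \<noteq> 0" using eq by auto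
  then show "inverse K > 0" by (simp add: K_def)
  obtain s where s: "s \<in> Pos" "s * s = c"
    using pos_sqrt [OF unital_subalgebra_UNIV c(2) UNIV_I] by metis
  have "s\<^sup>\<star> * (of_real (norm c) - c) * s \<in> Pos"
    using cs by (intro pos_conj sa_le_norm) auto
  moreover have "s\<^sup>\<star> * (of_real (norm c) - c) * s = norm c *\<^sub>R c - c * c"
    using s by (simp add: pos_sa of_real_def algebra_simps flip: s(2))
  ultimately have 1: "y\<^sup>\<star> * (norm c *\<^sub>R c - c * c) * y \<in> Pos"
    by (metis pos_conj)
  have "(c * y)\<^sup>\<star> * (of_real ((norm x)\<^sup>2) - x\<^sup>\<star> * x) * (c * y) \<in> Pos"
    by (intro pos_conj star_mult_le_norm)
  moreover have "(c * y)\<^sup>\<star> * (x\<^sup>\<star> * x) * (c * y) = (x * c * y)\<^sup>\<star> * (x * c * y)"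
    by (simp add: star_simps mult.assoc)
  then have "(c * y)\<^sup>\<star> * (x\<^sup>\<star> * x) * (c * y) = 1" by (simp add: eq)
  ultimately have 2: "(norm x)\<^sup>2 *\<^sub>R (y\<^sup>\<star> * (c * c) * y) - 1 \<in> Pos"
    using cs by (simp add: algebra_simps of_real_def star_simps)
  have "(norm x)\<^sup>2 *\<^sub>R (y\<^sup>\<star> * (norm c *\<^sub>R c - c * c) * y) + ((norm x)\<^sup>2 *\<^sub>R (y\<^sup>\<star> * (c * c) * y) - 1) \<in> Pos"
    using 1 2 by (intro pos_add pos_scaleR) auto
  moreover have "(norm x)\<^sup>2 *\<^sub>R (y\<^sup>\<star> * (norm c *\<^sub>R c - c * c) * y) + ((norm x)\<^sup>2 *\<^sub>R (y\<^sup>\<star> * (c * c) * y) - 1) =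
      K *\<^sub>R (y\<^sup>\<star> * c * y) - 1"
    by (simp add: algebra_simps K_def)
  ultimately have "inverse K *\<^sub>R (K *\<^sub>R (y\<^sup>\<star> * c * y) - 1) \<in> Pos"
    using \<open>inverse K > 0\<close> by (intro pos_scaleR) auto
  then show "y\<^sup>\<star> * c * y - of_real (inverse K) \<in> Pos"
    using \<open>inverse K > 0\<close> by (simp add: algebra_simps of_real_def)
qed (use that in blast)

section \<open>Pure infiniteness in terms of isometries\<close>

lemma norm_mult3_ineq: "norm (a * b * c) \<le> norm a * norm b * norm (c::'a::real_normed_algebra)"
  by (rule order_trans [OF norm_mult_ineq]) (simp add: mult_right_mono norm_mult_ineq)

lemma star_mult_eq_zero: "x\<^sup>\<star> * x = 0 \<longleftrightarrow> x = (0::'a::unital_cstar_algebra)"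
  using norm_star_mult [of x] by auto

lemma sa_mult_self_eq_zero: "a\<^sup>\<star> = a \<Longrightarrow> a * a = 0 \<longleftrightarrow> a = (0::'a::unital_cstar_algebra)"
  using star_mult_eq_zero [of a] by simp

text \<open>Cuntz subequivalence of \<open>1\<close> to \<open>b\<close> in exact form; an
  approximate version can be normalised by \<open>conj_one_if_ge\<close>.\<close>

definition unit_subequiv_all :: "'a::unital_cstar_algebra set \<Rightarrow> bool" where
  "unit_subequiv_all D \<longleftrightarrow> (\<forall>b\<in>D \<inter> Pos - {0}. \<exists>v\<in>D. v * b * v\<^sup>\<star> = 1)"

definition proper_isometry_in :: "'a::unital_cstar_algebra set \<Rightarrow> 'a \<Rightarrow> bool" where
  "proper_isometry_in D u \<longleftrightarrow> u \<in> D \<and> u\<^sup>\<star> * u = 1 \<and> u * u\<^sup>\<star> \<noteq> 1"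

lemma unit_subequiv_square:
  assumes D: "unital_subalgebra D" "unit_subequiv_all D" and b: "b \<in> D" "b\<^sup>\<star> = b" "b \<noteq> 0"
  obtains v where "v \<in> D" "v * (b * b) * v\<^sup>\<star> = 1"
proof -
  have "b * b \<in> D \<inter> Pos - {0}"
    using b sub_mult [OF D(1)] by (auto simp: pos_square sa_mult_self_eq_zero)
  with D(2) that show thesis by (auto simp: unit_subequiv_all_def)
qed

lemma isometry_range_projection:
  assumes "s\<^sup>\<star> * s = 1" and p: "p\<^sup>\<star> = p" "p * p = p"
  shows "(s * p * s\<^sup>\<star>)\<^sup>\<star> = s * p * s\<^sup>\<star>" "s * p * s\<^sup>\<star> * (s * p * s\<^sup>\<star>) = s * p * s\<^sup>\<star>"
proof -
  show "(s * p * s\<^sup>\<star>)\<^sup>\<star> = s * p * s\<^sup>\<star>" using p by (simp add: star_simps mult.assoc)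
  have "s * p * s\<^sup>\<star> * (s * p * s\<^sup>\<star>) = s * p * (s\<^sup>\<star> * s) * (p * s\<^sup>\<star>)" by (simp only: mult.assoc)
  also have "\<dots> = s * (p * p) * s\<^sup>\<star>" unfolding assms(1) by (simp only: mult.assoc mult_1_left)
  finally show "s * p * s\<^sup>\<star> * (s * p * s\<^sup>\<star>) = s * p * s\<^sup>\<star>" by (simp add: p)
qed

lemma isometry_range:
  assumes "u\<^sup>\<star> * u = (1::'a::unital_cstar_algebra)"
  shows "(u * u\<^sup>\<star>)\<^sup>\<star> = u * u\<^sup>\<star>" "u * u\<^sup>\<star> * (u * u\<^sup>\<star>) = u * u\<^sup>\<star>"
  using isometry_range_projection [OF assms, of 1] by simp_all

text \<open>From \<open>v b^2 v\<^sup>\<star> = 1\<close> the element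
  \<open>s = b v\<^sup>\<star>\<close> is an isometry whose range projection is dominated by a
  multiple of \<open>b^2\<close>, hence lies in \<open>H\<close>. Conjugating \<open>u\<close> by
  \<open>s\<close> makes this projection infinite. For simplicity, a nonzero \<open>y\<close> in an
  ideal puts \<open>v y\<^sup>\<star> y v\<^sup>\<star> = 1\<close> there.\<close>

lemma purely_infinite_if_unit_subequiv:
  assumes D: "unital_subalgebra D" "unit_subequiv_all D" and u: "proper_isometry_in D u"
  shows "purely_infinite D"
  unfolding purely_infinite_def
proof (intro conjI allI impI)
  show "simple_cstar D"
    unfolding simple_cstar_def
  proof (intro conjI allI impI)
    show "D \<noteq> {0}" using sub_one [OF D(1)] by auto
    fix I assume I: "closed_ideal D I"
    show "I = {0} \<or> I = D"
    proof (cases "I = {0}")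
      case False
      moreover have "0 \<in> I" using I by (auto simp: closed_ideal_def complex_vector.subspace_0)
      ultimately obtain y where y: "y \<in> I" "y \<noteq> 0" by auto
      have *: "x * z \<in> I" "z * x \<in> I" if "x \<in> D" "z \<in> I" for x z
        using I that by (auto simp: closed_ideal_def)
      have yD: "y \<in> D" "y\<^sup>\<star> \<in> D" using I y sub_star [OF D(1)] by (auto simp: closed_ideal_def)
      then have "y\<^sup>\<star> * y \<in> I" "y\<^sup>\<star> * y \<in> D" using * y sub_mult [OF D(1)] by auto
      moreover from this have "y\<^sup>\<star> * y \<in> D \<inter> Pos - {0}"
        using pos_star_mult [of y] y by (simp add: star_mult_eq_zero)
      with D(2) obtain v where v: "v \<in> D" "v * (y\<^sup>\<star> * y) * v\<^sup>\<star> = 1"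
        unfolding unit_subequiv_all_def by blast
      ultimately have "1 \<in> I" using * sub_star [OF D(1) v(1)] by metis
      then have "D \<subseteq> I" using *(1) by fastforce
      with I show ?thesis by (auto simp: closed_ideal_def)
    qed simp
  qed
next
  fix H assume "hereditary_subalgebra D H \<and> H \<noteq> {0}"
  then have H: "cstar_subalgebra H" "H \<subseteq> D" "H \<noteq> {0}"
    "\<And>a b. \<lbrakk>a \<in> D; b \<in> H; cstar_le D 0 a; cstar_le D a b\<rbrakk> \<Longrightarrow> a \<in> H"
    by (auto simp: hereditary_subalgebra_def)
  have Hsub: "complex_vector.subspace H" using H by (simp add: cstar_subalgebra_def)
  then have "0 \<in> H" by (rule complex_vector.subspace_0)
  with H(3) obtain h where h: "h \<in> H" "h \<noteq> 0" by auto
  define b where "b = h\<^sup>\<star> * h"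
  have b: "b \<in> H" "b\<^sup>\<star> = b" "b \<noteq> 0" "b \<in> D" "b * b \<in> H"
    using h H(1,2) by (auto simp: b_def cstar_subalgebra_def star_simps star_mult_eq_zero)
  obtain v where v: "v \<in> D" "v * (b * b) * v\<^sup>\<star> = 1"
    using unit_subequiv_square [OF D b(4,2,3)] by blast
  define s where "s = b * v\<^sup>\<star>"
  have s: "s\<^sup>\<star> * s = 1" "s \<in> D" "s\<^sup>\<star> \<in> D"
    using v b sub_mult [OF D(1)] sub_star [OF D(1)] by (auto simp: s_def star_simps mult.assoc)
  have u: "u \<in> D" "u\<^sup>\<star> \<in> D" "u\<^sup>\<star> * u = 1" "u * u\<^sup>\<star> \<noteq> 1"
    using u sub_star [OF D(1)] by (auto simp: proper_isometry_in_def)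
  define p where "p = s * s\<^sup>\<star>"
  define q where "q = s * (u * u\<^sup>\<star>) * s\<^sup>\<star>"
  have pq: "p \<in> D" "q \<in> D" using s u sub_mult [OF D(1)] by (auto simp: p_def q_def)
  have ppos: "p \<in> Pos" using pos_conj' [OF pos_one, of s] by (simp add: p_def)
  have "b\<^sup>\<star> * (of_real ((norm v)\<^sup>2) - v\<^sup>\<star> * v) * b \<in> Pos"
    by (intro pos_conj star_mult_le_norm)
  then have ple: "(norm v)\<^sup>2 *\<^sub>R (b * b) - p \<in> Pos"
    by (simp add: b p_def s_def star_simps algebra_simps of_real_def)
  have bbH: "(norm v)\<^sup>2 *\<^sub>R (b * b) \<in> H"
    unfolding scaleR_scaleC using Hsub b(5) by (rule complex_vector.subspace_scale)
  show "\<exists>p\<in>H. infinite_projection D p"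
  proof
    show "p \<in> H"
      using ppos ple bbH H(2) pq by (intro H(4) [OF pq(1) bbH]) (auto simp: cstar_le_iff [OF D(1)] sub_zero [OF D(1)])
    show "infinite_projection D p"
      unfolding infinite_projection_def
    proof (intro conjI bexI)
      show "p \<in> projections D"
        using pq isometry_range [OF s(1)] by (auto simp: projections_def p_def)
      show "q \<in> projections D"
        using pq isometry_range_projection [OF s(1) isometry_range [OF u(3)]]
        by (auto simp: projections_def q_def)
      have e: "(1 - u * u\<^sup>\<star>)\<^sup>\<star> * (1 - u * u\<^sup>\<star>) = 1 - u * u\<^sup>\<star>"
        using isometry_range [OF u(3)] by (simp add: star_diff algebra_simps)
      have "s * ((1 - u * u\<^sup>\<star>)\<^sup>\<star> * (1 - u * u\<^sup>\<star>)) * s\<^sup>\<star> \<in> Pos"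
        by (intro pos_conj' pos_star_mult)
      then have "s * (1 - u * u\<^sup>\<star>) * s\<^sup>\<star> \<in> Pos" unfolding e .
      moreover have pmq: "s * (1 - u * u\<^sup>\<star>) * s\<^sup>\<star> = p - q" by (simp add: p_def q_def algebra_simps)
      ultimately show "cstar_le D q p" using pq by (simp add: cstar_le_iff [OF D(1)])
      have ss: "s\<^sup>\<star> * (s * x * s\<^sup>\<star>) * s = x" for x
        using s(1) by (metis mult.assoc mult_1_left mult_1_right)
      show "q \<noteq> p"
      proof
        assume "q = p"
        then have "s * (1 - u * u\<^sup>\<star>) * s\<^sup>\<star> = 0" using pmq by simp
        then have "1 - u * u\<^sup>\<star> = 0" using ss [of "1 - u * u\<^sup>\<star>"] by simp
        with u show False by simp
      qed
      define t where "t = s * u * s\<^sup>\<star>"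
      have "t\<^sup>\<star> * t = s * (u\<^sup>\<star> * (s\<^sup>\<star> * s) * u) * s\<^sup>\<star>" "t * t\<^sup>\<star> = s * (u * (s\<^sup>\<star> * s) * u\<^sup>\<star>) * s\<^sup>\<star>"
        by (simp_all add: t_def star_simps mult.assoc)
      then have "t\<^sup>\<star> * t = p" "t * t\<^sup>\<star> = q" using s u by (simp_all add: p_def q_def)
      moreover have "t \<in> D" using s u sub_mult [OF D(1)] by (auto simp: t_def)
      ultimately show "mvn_equiv D p q" by (auto simp: mvn_equiv_def)
    qed
  qed
qed

text \<open>The order relation becomes algebraic by compressing \<open>p - q\<close> with
  \<open>1 - p\<close>: the result is \<open>- (z\<^sup>\<star> z)\<close> for
  \<open>z = q (1 - p)\<close>, and its positivity forces \<open>z = 0\<close>.\<close>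

lemma infinite_projectionE:
  assumes D: "unital_subalgebra D" and p: "infinite_projection D p"
  obtains v q where "p \<in> D" "q \<in> D" "v \<in> D" "v\<^sup>\<star> * v = p" "v * v\<^sup>\<star> = q" "q \<noteq> p"
    "p\<^sup>\<star> = p" "p * p = p" "q\<^sup>\<star> = q" "q * q = q" "p * q = q" "q * p = q"
    "v * p = v" "q * v = v" "p * v = v"
proof -
  obtain q v where pq: "p \<in> D" "q \<in> D" "v \<in> D" "v\<^sup>\<star> * v = p" "v * v\<^sup>\<star> = q" "q \<noteq> p"
    "p\<^sup>\<star> = p" "p * p = p" "q\<^sup>\<star> = q" "q * q = q" and le: "p - q \<in> Pos"
    using p by (auto simp: infinite_projection_def projections_def mvn_equiv_def cstar_le_iff [OF D])
  have "(v * (1 - p))\<^sup>\<star> * (v * (1 - p)) = (1 - p) * (v\<^sup>\<star> * v) * (1 - p)"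
    by (simp only: star_mult star_diff star_one pq(7) mult.assoc)
  also have "\<dots> = 0" using pq by (simp add: algebra_simps)
  finally have "v * (1 - p) = 0" by (simp only: star_mult_eq_zero)
  then have vp: "v * p = v" by (simp add: algebra_simps)
  then have qv: "q * v = v" using pq by (metis mult.assoc)
  have "(1 - p)\<^sup>\<star> * (p - q) * (1 - p) \<in> Pos" using le by (rule pos_conj)
  moreover have qq: "(q * (1 - p))\<^sup>\<star> * (q * (1 - p)) = (1 - p) * q * (1 - p)"
  proof -
    have "(q * (1 - p))\<^sup>\<star> * (q * (1 - p)) = (1 - p) * (q * q) * (1 - p)"
      by (simp only: star_mult star_diff star_one pq(7,9) mult.assoc)
    then show ?thesis by (simp only: pq(10))
  qed
  have "(1 - p)\<^sup>\<star> * (p - q) * (1 - p) = - ((q * (1 - p))\<^sup>\<star> * (q * (1 - p)))"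
    unfolding qq using pq by (simp add: star_simps algebra_simps)
  ultimately have "- ((q * (1 - p))\<^sup>\<star> * (q * (1 - p))) \<in> Pos" by simp
  then have "q * (1 - p) = 0" by (rule star_mult_neg_imp_zero)
  then have qp: "q * p = q" by (simp add: algebra_simps)
  then have "p * q = q" using pq by (metis star_mult)
  moreover from this have "p * v = v" using qv by (metis mult.assoc)
  ultimately show thesis using that pq vp qv qp by blast
qed

text \<open>Adding \<open>1 - p\<close> to the partial isometry \<open>v\<close> gives an isometry
  with range projection \<open>1 - (p - q)\<close>.\<close>

lemma infinite_projection_imp_proper_isometry:
  assumes D: "unital_subalgebra D" and p: "infinite_projection D p"
  obtains u where "proper_isometry_in D u"
proof -
  obtain v q where pq: "p \<in> D" "q \<in> D" "v \<in> D" "v\<^sup>\<star> * v = p" "v * v\<^sup>\<star> = q" "q \<noteq> p"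
    "p\<^sup>\<star> = p" "p * p = p" "v * p = v" "p * v = v"
    using infinite_projectionE [OF D p] by metis
  have vs: "p * v\<^sup>\<star> = v\<^sup>\<star>" "v\<^sup>\<star> * p = v\<^sup>\<star>" using pq by (metis star_mult)+
  define u where "u = v + (1 - p)"
  have "u\<^sup>\<star> * u = 1" "u * u\<^sup>\<star> = q + (1 - p)"
    using pq vs by (simp_all add: u_def star_simps algebra_simps)
  moreover have "u \<in> D" unfolding u_def using D pq by (intro sub_intros) auto
  ultimately have "proper_isometry_in D u" using pq by (auto simp: proper_isometry_in_def)
  with that show thesis .
qed

section \<open>Fullness of infinite projections in a simple algebra\<close>

lemma closure_subspace:
  fixes S :: "'a::unital_cstar_algebra set"
  assumes S: "complex_vector.subspace S"
  shows "complex_vector.subspace (closure S)"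
  unfolding complex_vector.subspace_def
proof (intro conjI ballI allI)
  show "0 \<in> closure S" using complex_vector.subspace_0 [OF S] closure_subset by blast
next
  fix x y assume "x \<in> closure S" "y \<in> closure S"
  then obtain f g where "\<And>n. f n \<in> S" "f \<longlonglongrightarrow> x" "\<And>n. g n \<in> S" "g \<longlonglongrightarrow> y"
    by (auto simp: closure_sequential)
  then show "x + y \<in> closure S"
    unfolding closure_sequential
    by (intro exI [of _ "\<lambda>n. f n + g n"]) (auto intro: tendsto_add complex_vector.subspace_add [OF S])
next
  fix c x assume "x \<in> closure S"
  then obtain f where "\<And>n. f n \<in> S" "f \<longlonglongrightarrow> x"
    by (auto simp: closure_sequential)
  then show "c *\<^sub>C x \<in> closure S"
    unfolding closure_sequential
    by (intro exI [of _ "\<lambda>n. c *\<^sub>C f n"]) (auto intro: tendsto_scaleC complex_vector.subspace_scale [OF S])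
qed

lemma closure_mult_left:
  fixes S :: "'a::unital_cstar_algebra set"
  assumes "\<And>y. y \<in> S \<Longrightarrow> x * y \<in> S" and "y \<in> closure S"
  shows "x * y \<in> closure S"
proof -
  obtain f where "\<And>n. f n \<in> S" "f \<longlonglongrightarrow> y" using assms(2) by (auto simp: closure_sequential)
  with assms(1) show ?thesis
    unfolding closure_sequential by (intro exI [of _ "\<lambda>n. x * f n"]) (auto intro: tendsto_mult_left)
qed

lemma closure_mult_right:
  fixes S :: "'a::unital_cstar_algebra set"
  assumes "\<And>y. y \<in> S \<Longrightarrow> y * x \<in> S" and "y \<in> closure S"
  shows "y * x \<in> closure S"
proof -
  obtain f where "\<And>n. f n \<in> S" "f \<longlonglongrightarrow> y" using assms(2) by (auto simp: closure_sequential)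
  with assms(1) show ?thesis
    unfolding closure_sequential by (intro exI [of _ "\<lambda>n. f n * x"]) (auto intro: tendsto_mult_right)
qed

text \<open>Cuntz' argument: with \<open>v\<^sup>\<star> v = p\<close> and \<open>v v\<^sup>\<star> = q < p\<close>, the projections
  \<open>v\<^sup>n (p - q) v\<^sup>\<star>\<^sup>n\<close> are orthogonal and equivalent to \<open>p - q\<close>, so that a sum of products
  \<open>x (p - q) y\<close> collapses to a single product \<open>w p w'\<close>.\<close>
lemma infinite_projection_full:
  assumes D: "unital_subalgebra D" and simple: "simple_cstar D" and p: "infinite_projection D p"
  obtains w w' where "w \<in> D" "w' \<in> D" "w * p * w' = 1"
proof -
  obtain v q where pq: "p \<in> D" "q \<in> D" "v \<in> D" "v\<^sup>\<star> * v = p" "q \<noteq> p"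
    "p\<^sup>\<star> = p" "p * p = p" "q\<^sup>\<star> = q" "q * q = q" "p * q = q" "q * p = q" "p * v = v" "q * v = v"
    using infinite_projectionE [OF D p] by metis
  define e where "e = p - q"
  have e: "e \<in> D" "e \<noteq> 0" "e\<^sup>\<star> = e" "e * e = e" "p * e = e" "e * p = e" "e * v = 0"
    using pq sub_diff [OF D] by (simp_all add: e_def star_simps algebra_simps)
  have vD: "v ^ n \<in> D" "v\<^sup>\<star> ^ n \<in> D" for n
    using pq(3) sub_power [OF D] sub_star [OF D] by auto
  have pvn: "p * (v ^ n * y) = v ^ n * y" if "p * y = y" for n y
  proof (cases n)
    case (Suc m)
    have "p * (v ^ n * y) = p * v * (v ^ m * y)" by (simp add: Suc mult.assoc)
    then show ?thesis using pq by (simp add: Suc mult.assoc)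
  qed (use that in simp)
  have vvn: "v\<^sup>\<star> ^ n * (v ^ n * y) = y" if "p * y = y" for n y
  proof (induction n)
    case (Suc n)
    have "v\<^sup>\<star> ^ Suc n * (v ^ Suc n * y) = v\<^sup>\<star> ^ n * (v\<^sup>\<star> * v * (v ^ n * y))"
      by (simp only: power_Suc2 [of "v\<^sup>\<star>"] power_Suc [of v] mult.assoc)
    then show ?case using Suc pvn [OF that] pq by simp
  qed simp
  have eve: "e * (v\<^sup>\<star> ^ n * (v ^ m * e)) = 0" if "m > n" for n m
  proof -
    have "v ^ m * e = v ^ n * (v * (v ^ (m - Suc n) * e))"
      using that by (simp flip: power_add power_Suc mult.assoc)
    moreover have "p * (v * (v ^ (m - Suc n) * e)) = v * (v ^ (m - Suc n) * e)"
      using pq by (simp flip: mult.assoc)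
    ultimately have "v\<^sup>\<star> ^ n * (v ^ m * e) = v * (v ^ (m - Suc n) * e)" using vvn by metis
    then show ?thesis using e by (simp flip: mult.assoc)
  qed
  have eve': "e * (v\<^sup>\<star> ^ m * (v ^ n * e)) = 0" if "m > n" for n m
    using arg_cong [OF eve [OF that], of star] e by (simp add: star_simps mult.assoc)
  define S where "S = {x * e * y | x y. x \<in> D \<and> y \<in> D}"
  define J where "J = complex_vector.span S"
  \<comment> \<open>The invariant leaves room for the next summand: every copy
    \<open>v ^ m * e\<close> with \<open>m \<ge> n\<close> is orthogonal to \<open>w\<close> and
    \<open>w'\<close>, so a new term placed at index \<open>n\<close> creates no cross terms. The
    clause \<open>w * p = w\<close> allows \<open>p\<close> to be inserted at the end.\<close>
  have J: "\<exists>n w w'. w \<in> D \<and> w' \<in> D \<and> w * w' = u \<and> w * p = w \<and>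
      (\<forall>m\<ge>n. w * (v ^ m * e) = 0 \<and> e * (v\<^sup>\<star> ^ m * w') = 0)" if "u \<in> J" for u
    using that unfolding J_def
  proof (induction rule: complex_vector.span_induct_alt)
    case base
    show ?case using D by (intro exI [of _ 0]) auto
  next
    case (step c z u)
    then obtain x y where xy: "x \<in> D" "y \<in> D" "z = x * e * y" by (auto simp: S_def)
    define x' where "x' = c *\<^sub>C x"
    have x': "x' \<in> D" "c *\<^sub>C z = x' * e * y"
      using xy sub_scaleC [OF D] by (auto simp: x'_def mult_scaleC_left)
    from step obtain n w w' where w: "w \<in> D" "w' \<in> D" "w * w' = u" "w * p = w"
      and o: "\<And>m. m \<ge> n \<Longrightarrow> w * (v ^ m * e) = 0" "\<And>m. m \<ge> n \<Longrightarrow> e * (v\<^sup>\<star> ^ m * w') = 0"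
      by blast
    define w1 where "w1 = w + x' * e * v\<^sup>\<star> ^ n"
    define w1' where "w1' = w' + v ^ n * e * y"
    have "w1 \<in> D" "w1' \<in> D"
      unfolding w1_def w1'_def using w x' xy e vD by (auto intro!: sub_mult [OF D] sub_add [OF D])
    moreover have "w1 * w1' = c *\<^sub>C z + u"
    proof -
      have "w1 * w1' = w * w' + w * (v ^ n * e) * y + x' * (e * (v\<^sup>\<star> ^ n * w')) +
          x' * e * (v\<^sup>\<star> ^ n * (v ^ n * e)) * y"
        by (simp add: w1_def w1'_def distrib_left distrib_right mult.assoc)
      also have "\<dots> = u + x' * (e * e) * y"
        using o [of n] w e vvn [OF e(5), of n] by (simp add: mult.assoc)
      finally show ?thesis by (simp add: x' e add.commute)
    qed
    moreover have "w1 * p = w1"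
    proof -
      have "e * (v\<^sup>\<star> ^ n * p) = e * v\<^sup>\<star> ^ n"
        using arg_cong [OF pvn [OF e(5)], of star n] e pq by (simp add: star_simps mult.assoc)
      then show ?thesis using w by (simp add: w1_def distrib_right mult.assoc)
    qed
    moreover have "w1 * (v ^ m * e) = 0 \<and> e * (v\<^sup>\<star> ^ m * w1') = 0" if "m \<ge> Suc n" for m
    proof -
      have "w1 * (v ^ m * e) = w * (v ^ m * e) + x' * (e * (v\<^sup>\<star> ^ n * (v ^ m * e)))"
        "e * (v\<^sup>\<star> ^ m * w1') = e * (v\<^sup>\<star> ^ m * w') + e * (v\<^sup>\<star> ^ m * (v ^ n * e)) * y"
        by (simp_all add: w1_def w1'_def distrib_left distrib_right mult.assoc)
      then show ?thesis using o [of m] eve [of n m] eve' [of n m] that by simp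
    qed
    ultimately show ?case by blast
  qed
  have Jsub: "complex_vector.subspace J" by (simp add: J_def)
  have Jmult: "x * u \<in> J \<and> u * x \<in> J" if "x \<in> D" "u \<in> J" for x u
    using that(2) unfolding J_def
  proof (induction rule: complex_vector.span_induct_alt)
    case (step c z u)
    then obtain x1 y1 where xy: "x1 \<in> D" "y1 \<in> D" "z = x1 * e * y1" by (auto simp: S_def)
    have "x * z = x * x1 * e * y1" "z * x = x1 * e * (y1 * x)" by (simp_all add: xy mult.assoc)
    then have "x * z \<in> S" "z * x \<in> S" unfolding S_def using xy that(1) sub_mult [OF D] by blast+
    then have "x * z \<in> complex_vector.span S" "z * x \<in> complex_vector.span S"
      by (auto intro: complex_vector.span_base)
    then show ?case
      using step by (auto simp: distrib_left distrib_right mult_scaleC_left mult_scaleC_right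
          intro!: complex_vector.span_add complex_vector.span_scale)
  qed (simp add: complex_vector.span_zero)
  have "S \<subseteq> D" using e sub_mult [OF D] by (auto simp: S_def)
  then have "J \<subseteq> D" unfolding J_def using sub_subspace [OF D] by (rule complex_vector.span_minimal)
  then have "closure J \<subseteq> D" using sub_closed [OF D] by (rule closure_minimal)
  then have "closed_ideal D (closure J)"
    unfolding closed_ideal_def
    using closure_subspace [OF Jsub] Jmult closure_mult_left [of J] closure_mult_right [of J] by auto
  moreover have "1 * e * 1 \<in> S" unfolding S_def using sub_one [OF D] by blast
  then have "e \<in> closure J" unfolding J_def using closure_subset complex_vector.span_base by fastforce
  ultimately have "closure J = D" using simple e(2) by (auto simp: simple_cstar_def)
  then have "1 \<in> closure J" using sub_one [OF D] by simp
  then obtain u where u: "u \<in> J" "dist u 1 < 1"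
    using closure_approachable [of 1 J] zero_less_one by blast
  have "invertible_in D u"
    using u \<open>J \<subseteq> D\<close> by (intro neumann [OF D]) (auto simp: dist_norm norm_minus_commute)
  then obtain b where b: "b \<in> D" "b * u = 1" by (auto simp: invertible_in_def)
  obtain w w' where w: "w \<in> D" "w' \<in> D" "w * w' = u" "w * p = w" using J [OF u(1)] by blast
  have "b * w * p * w' = b * ((w * p) * w')" by (simp only: mult.assoc)
  then have "b * w * p * w' = 1" using b w by simp
  with that b w sub_mult [OF D] show thesis by blast
qed

section \<open>Hereditary subalgebras from closed left ideals\<close>

text \<open>With \<open>k = (h + \<eta>)\<^sup>-\<^sup>1\<close>, the elements \<open>k h\<close> form an approximate unit for everything below \<open>h\<close>.\<close>
lemma sqrt_approx_below:
  assumes D: "unital_subalgebra D" and h: "h \<in> D" and a: "a \<in> Pos" "h - a \<in> Pos"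
    and s: "s \<in> Pos" "s * s = a" and \<eta>: "\<eta> > 0"
  obtains k where "k \<in> D" "norm (s - s * k * h) \<le> sqrt \<eta>"
proof -
  have hpos: "h \<in> Pos" using pos_add [OF a] by simp
  have "invertible_in D (h + of_real \<eta>)"
    using \<eta> h hpos sub_add [OF D] sub_of_real [OF D]
    by (intro invertible_in_if_ge [OF D, where \<delta> = \<eta>]) auto
  then obtain k where k: "k \<in> D" "k * (h + of_real \<eta>) = 1" "(h + of_real \<eta>) * k = 1"
    by (auto simp: invertible_in_def)
  have "k\<^sup>\<star> * (h + of_real \<eta>) = 1" using arg_cong [OF k(3), of star] hpos by (simp add: star_simps pos_sa)
  then have ks: "k\<^sup>\<star> = k" using k(3) by (metis mult.assoc mult_1_left mult_1_right)
  have kh: "1 - k * h = \<eta> *\<^sub>R k" "h * k = 1 - \<eta> *\<^sub>R k"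
    using k by (simp_all add: algebra_simps of_real_def)
  have "norm (s * (\<eta> *\<^sub>R k)) \<le> sqrt \<eta>"
  proof -
    have *: "(s * (\<eta> *\<^sub>R k))\<^sup>\<star> * (s * (\<eta> *\<^sub>R k)) = (\<eta> *\<^sub>R k) * a * (\<eta> *\<^sub>R k)"
      using s ks by (simp add: star_simps pos_sa mult.assoc flip: s(2))
    \<comment> \<open>This is \<open>(h + \<eta>)^2 - \<eta> h = h^2 + \<eta> h + \<eta>^2\<close>,
      compressed by \<open>k\<close>; it bounds \<open>\<eta>^2 k h k\<close>, and hence
      \<open>\<eta>^2 k a k\<close>, by \<open>\<eta>\<close>.\<close>
    have "of_real \<eta> - (\<eta> *\<^sub>R k) * h * (\<eta> *\<^sub>R k) = \<eta> *\<^sub>R (k\<^sup>\<star> * (h * h + \<eta> *\<^sub>R h + of_real (\<eta>\<^sup>2)) * k)"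
    proof -
      have "k * (h * h + \<eta> *\<^sub>R h + of_real (\<eta>\<^sup>2)) * k =
          k * (h + of_real \<eta>) * ((h + of_real \<eta>) * k) - \<eta> *\<^sub>R (k * h * k)"
        by (simp add: algebra_simps of_real_def power2_eq_square)
      then have "k * (h * h + \<eta> *\<^sub>R h + of_real (\<eta>\<^sup>2)) * k = 1 - \<eta> *\<^sub>R (k * h * k)"
        by (simp only: k mult_1_left)
      then show ?thesis by (simp add: ks scaleR_right_diff_distrib of_real_def)
    qed
    also have "\<dots> \<in> Pos"
      using hpos \<eta> by (intro pos_scaleR pos_conj pos_add pos_square pos_of_real) (auto simp: pos_sa)
    finally have "of_real \<eta> - (\<eta> *\<^sub>R k) * h * (\<eta> *\<^sub>R k) + (\<eta> *\<^sub>R k)\<^sup>\<star> * (h - a) * (\<eta> *\<^sub>R k) \<in> Pos"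
      using a by (intro pos_add pos_conj) auto
    then have "of_real \<eta> - (\<eta> *\<^sub>R k) * a * (\<eta> *\<^sub>R k) \<in> Pos"
      by (simp add: star_simps ks algebra_simps)
    moreover have "(\<eta> *\<^sub>R k) * a * (\<eta> *\<^sub>R k) \<in> Pos" unfolding * [symmetric] by (rule pos_star_mult)
    ultimately have "norm ((\<eta> *\<^sub>R k) * a * (\<eta> *\<^sub>R k)) \<le> \<eta>" using \<eta> by (intro pos_norm_le) auto
    then have "(norm (s * (\<eta> *\<^sub>R k)))\<^sup>2 \<le> \<eta>" by (simp only: * norm_star_mult [symmetric])
    then show ?thesis by (rule real_le_rsqrt)
  qed
  moreover have "s * (\<eta> *\<^sub>R k) = s - s * k * h" unfolding kh(1) [symmetric] by (simp add: algebra_simps)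
  ultimately have "norm (s - s * k * h) \<le> sqrt \<eta>" by (simp only:)
  with k(1) show thesis by (rule that)
qed

text \<open>For \<open>a\<close> below \<open>h\<close> in \<open>L\<close>, the root
  \<open>s\<close> of \<open>a\<close> is a limit of elements \<open>s k h\<close> of
  \<open>L\<close>, so \<open>a = s s\<close> is in \<open>L\<close>.\<close>

lemma hereditary_subalgebra_left_ideal:
  assumes D: "unital_subalgebra D" and L: "L \<subseteq> D" "complex_vector.subspace L" "closed L"
    and mult: "\<And>x y. x \<in> D \<Longrightarrow> y \<in> L \<Longrightarrow> x * y \<in> L"
  shows "hereditary_subalgebra D {x \<in> L. x\<^sup>\<star> \<in> L}" (is "hereditary_subalgebra D ?H")
  unfolding hereditary_subalgebra_def cstar_subalgebra_def
proof (intro conjI ballI impI)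
  show "complex_vector.subspace ?H"
    using L(2) by (auto simp: complex_vector.subspace_def star_add star_scaleC)
  show "closed ?H"
    unfolding closed_sequential_limits
  proof (intro allI impI)
    fix f x assume f: "(\<forall>n. f n \<in> ?H) \<and> f \<longlonglongrightarrow> x"
    then have "(\<lambda>n. (f n)\<^sup>\<star>) \<longlonglongrightarrow> x\<^sup>\<star>" by (intro tendsto_intros) auto
    moreover have "\<forall>n. f n \<in> L \<and> (f n)\<^sup>\<star> \<in> L" using f by auto
    ultimately show "x \<in> ?H"
      using f closed_sequentially [OF L(3), of f x] closed_sequentially [OF L(3), of "\<lambda>n. (f n)\<^sup>\<star>" "x\<^sup>\<star>"]
      by simp
  qed
  show "x * y \<in> ?H" if "x \<in> ?H" "y \<in> ?H" for x y
    using that mult [of x y] mult [of "y\<^sup>\<star>" "x\<^sup>\<star>"] L(1) by (auto simp: star_mult)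
  show "x\<^sup>\<star> \<in> ?H" if "x \<in> ?H" for x using that by (simp add: star_star)
  show "?H \<subseteq> D" using L(1) by auto
  show "a \<in> ?H" if aD: "a \<in> D" and "h \<in> ?H" and le: "cstar_le D 0 a \<and> cstar_le D a h" for a h
  proof -
    have h: "h \<in> D" "h \<in> L" using \<open>h \<in> ?H\<close> L(1) by auto
    have a: "a \<in> Pos" "h - a \<in> Pos"
      using aD le h by (auto simp: cstar_le_iff [OF D] sub_zero [OF D])
    obtain s where s: "s \<in> Pos" "s \<in> D" "s * s = a" using pos_sqrt [OF D a(1) aD] by metis
    have "s \<in> closure L"
      unfolding closure_approachable
    proof (intro allI impI)
      fix e :: real assume e: "e > 0"
      then have "(e / 2)\<^sup>2 > 0" by simp
      then obtain k where k: "k \<in> D" "norm (s - s * k * h) \<le> sqrt ((e / 2)\<^sup>2)"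
        by (rule sqrt_approx_below [OF D h(1) a s(1,3)])
      then have "dist (s * k * h) s < e"
        using e by (simp add: dist_norm norm_minus_commute)
      moreover have "s * k * h \<in> L" using mult [OF sub_mult [OF D s(2) k(1)] h(2)] .
      ultimately show "\<exists>y\<in>L. dist y s < e" by blast
    qed
    then have "s \<in> L" using L(3) by simp
    then have "a \<in> L" using mult [OF s(2)] s(3) by auto
    then show ?thesis using pos_sa [OF a(1)] by simp
  qed
qed

text \<open>The hereditary subalgebra comes from the closed left ideal generated by
  \<open>b\<close>, so its infinite projection \<open>p\<close> is approximated by some
  \<open>d b\<close>. Substituting this into \<open>w p w' = 1\<close> leaves an invertible element,
  and \<open>1\<close> becomes a two-sided multiple of \<open>b\<close>.\<close>

lemma purely_infinite_imp_unit_subequiv: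
  assumes D: "unital_subalgebra D" and pi: "purely_infinite D"
  shows "unit_subequiv_all D"
  unfolding unit_subequiv_all_def
proof
  fix b assume "b \<in> D \<inter> Pos - {0}"
  then have b: "b \<in> D" "b \<in> Pos" "b\<^sup>\<star> = b" "b \<noteq> 0" by (auto simp: pos_sa)
  define S where "S = (\<lambda>d. d * b) ` D"
  define L where "L = closure S"
  have Ssub: "complex_vector.subspace S"
    unfolding complex_vector.subspace_def S_def
    using sub_zero [OF D] sub_add [OF D] sub_scaleC [OF D]
    by (auto simp: image_iff simp flip: distrib_right mult_scaleC_left intro: bexI [of _ 0])
  then have Lsub: "complex_vector.subspace L" unfolding L_def by (rule closure_subspace)
  have SD: "S \<subseteq> D" using b sub_mult [OF D] by (auto simp: S_def)
  then have LD: "L \<subseteq> D" unfolding L_def using sub_closed [OF D] by (rule closure_minimal)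
  have Lmult: "x * y \<in> L" if "x \<in> D" "y \<in> L" for x y
    unfolding L_def
  proof (rule closure_mult_left)
    show "x * z \<in> S" if "z \<in> S" for z
      using that \<open>x \<in> D\<close> sub_mult [OF D] by (auto simp: S_def simp flip: mult.assoc)
  qed (use that in \<open>simp add: L_def\<close>)
  define H where "H = {x \<in> L. x\<^sup>\<star> \<in> L}"
  have her: "hereditary_subalgebra D H"
    unfolding H_def using LD Lsub Lmult
    by (intro hereditary_subalgebra_left_ideal [OF D]) (auto simp: L_def)
  have "b \<in> H"
  proof -
    have "1 * b \<in> S" unfolding S_def using sub_one [OF D] by blast
    then show ?thesis using b closure_subset by (auto simp: H_def L_def)
  qed
  with her b have "\<exists>p\<in>H. infinite_projection D p" using pi by (auto simp: purely_infinite_def)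
  then obtain p where p: "p \<in> H" "infinite_projection D p"
    by blast
  obtain w w' where w: "w \<in> D" "w' \<in> D" "w * p * w' = 1"
    using infinite_projection_full [OF D _ p(2)] pi by (auto simp: purely_infinite_def)
  have "w \<noteq> 0" "w' \<noteq> 0" using w(3) by auto
  then have "norm w * norm w' > 0" by simp
  moreover have "p \<in> closure S" using p(1) by (simp add: H_def L_def)
  ultimately have "\<exists>y\<in>S. dist y p < inverse (norm w * norm w')"
    unfolding closure_approachable by (meson inverse_positive_iff_positive)
  then obtain d where d: "d \<in> D" "dist (d * b) p < inverse (norm w * norm w')"
    by (auto simp: S_def)
  have "1 - w * (d * b) * w' = w * (p - d * b) * w'"
    using w(3) by (simp add: algebra_simps)
  then have "norm (1 - w * (d * b) * w') \<le> norm w * norm (p - d * b) * norm w'"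
    by (simp only: norm_mult3_ineq)
  also have "\<dots> = (norm w * norm w') * dist (d * b) p" by (simp add: dist_norm norm_minus_commute)
  also have "\<dots> < (norm w * norm w') * inverse (norm w * norm w')"
    using d(2) \<open>norm w * norm w' > 0\<close> by (rule mult_strict_left_mono)
  also have "\<dots> = 1" using \<open>w \<noteq> 0\<close> \<open>w' \<noteq> 0\<close> by (simp add: field_simps)
  finally have "invertible_in D (w * (d * b) * w')"
    using w b d sub_mult [OF D] by (intro neumann [OF D]) auto
  then obtain k where k: "k \<in> D" "k * (w * (d * b) * w') = 1" by (auto simp: invertible_in_def)
  then have "(k * w * d) * b * w' = 1" by (simp add: mult.assoc)
  moreover have "k * w * d \<in> D" using k w d sub_mult [OF D] by blast
  ultimately obtain v where "v \<in> D" "v * b * v\<^sup>\<star> = 1"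
    using conj_one_if_mult_one [OF D b(1,2) _ w(2)] by metis
  then show "\<exists>v\<in>D. v * b * v\<^sup>\<star> = 1" by blast
qed

lemma purely_infinite_iff:
  assumes D: "unital_subalgebra D"
  shows "purely_infinite D \<longleftrightarrow> unit_subequiv_all D \<and> (\<exists>u. proper_isometry_in D u)"
proof
  assume pi: "purely_infinite D"
  have "hereditary_subalgebra D D" "D \<noteq> {0}"
    using D sub_one [OF D] by (auto simp: hereditary_subalgebra_def unital_subalgebra_def)
  then obtain p where "infinite_projection D p" using pi by (auto simp: purely_infinite_def)
  then show "unit_subequiv_all D \<and> (\<exists>u. proper_isometry_in D u)"
    using infinite_projection_imp_proper_isometry [OF D] purely_infinite_imp_unit_subequiv [OF D pi] by metis
qed (use purely_infinite_if_unit_subequiv D in blast)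

section \<open>Large subalgebras\<close>

lemma large_subalgebraE:
  assumes "large_subalgebra B" "x \<in> Pos" "norm x = 1" "y \<in> B" "y \<in> Pos" "y \<noteq> 0" "\<epsilon> > 0"
  obtains c g where "g \<in> B" "g \<in> Pos" "1 - g \<in> Pos" "norm (c - a) < \<epsilon>" "(1 - g) * c \<in> B"
    "cuntz_subequiv B g y" "norm ((1 - g) * x * (1 - g)) > 1 - \<epsilon>"
proof -
  have B: "unital_subalgebra B" using assms(1) by (simp add: large_subalgebra_def)
  have *: "(1::nat) \<ge> 1 \<and> \<epsilon> > 0 \<and> x \<in> Pos \<and> norm x = 1 \<and> y \<in> positives B - {0}"
    using assms B by (simp add: positives_eq)
  from assms(1) have "\<exists>(c :: nat \<Rightarrow> 'a) g. g \<in> B \<and> cstar_le B 0 g \<and> cstar_le B g 1 \<and>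
      (\<forall>j\<in>{1..1}. norm (c j - a) < \<epsilon>) \<and> (\<forall>j\<in>{1..1}. (1 - g) * c j \<in> B) \<and>
      cuntz_subequiv B g y \<and> cuntz_subequiv UNIV g x \<and> norm ((1 - g) * x * (1 - g)) > 1 - \<epsilon>"
    unfolding large_subalgebra_def using * by (elim conjE allE [of _ "1::nat"] allE [of _ "\<lambda>_. a"]) blast
  then obtain c :: "nat \<Rightarrow> 'a" and g where "g \<in> B" "cstar_le B 0 g" "cstar_le B g 1"
    "norm (c 1 - a) < \<epsilon>" "(1 - g) * c 1 \<in> B" "cuntz_subequiv B g y"
    "norm ((1 - g) * x * (1 - g)) > 1 - \<epsilon>" by auto
  then show thesis using that B by (simp add: cstar_le_iff sub_zero sub_one)
qed

lemma pos_contraction_complement: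
  assumes "g \<in> Pos" "1 - g \<in> Pos"
  shows "(1 - g)\<^sup>\<star> = 1 - g" "norm (1 - g) \<le> 1"
  using pos_norm_le [of "1 - g" 1] assms by (auto simp: pos_sa)

lemma pos_mono_norm:
  assumes "a \<in> Pos" "b - a \<in> Pos" shows "norm a \<le> norm b"
proof (rule pos_norm_le [OF assms(1)])
  have "b \<in> Pos" using pos_add [OF assms] by simp
  then have "of_real (norm b) - b \<in> Pos" by (intro sa_le_norm) (auto simp: pos_sa)
  from pos_add [OF this assms(2)] show "of_real (norm b) - a \<in> Pos" by simp
qed simp

lemma norm_mult_star_diff:
  fixes c w m :: "'a::unital_cstar_algebra"
  assumes "norm (c - w) \<le> \<epsilon>" and "\<epsilon> \<le> 1"
  shows "norm (c * m * c\<^sup>\<star> - w * m * w\<^sup>\<star>) \<le> norm m * (2 * norm w + 1) * \<epsilon>"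
proof -
  have \<epsilon>: "\<epsilon> \<ge> 0" using assms(1) norm_ge_zero order_trans by blast
  have cw: "norm (c\<^sup>\<star> - w\<^sup>\<star>) \<le> \<epsilon>" using assms(1) by (simp flip: star_diff)
  have c: "norm c \<le> norm w + \<epsilon>" using norm_triangle_sub [of c w] assms by simp
  have "norm ((c - w) * m * c\<^sup>\<star>) \<le> norm (c - w) * norm m * norm c"
    using norm_mult3_ineq [of "c - w" m "c\<^sup>\<star>"] by simp
  also have "\<dots> \<le> \<epsilon> * norm m * (norm w + \<epsilon>)"
    using assms c \<epsilon> by (intro mult_mono) auto
  finally have 1: "norm ((c - w) * m * c\<^sup>\<star>) \<le> \<epsilon> * norm m * (norm w + \<epsilon>)" .
  have "norm (w * m * (c\<^sup>\<star> - w\<^sup>\<star>)) \<le> norm w * norm m * norm (c\<^sup>\<star> - w\<^sup>\<star>)"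
    by (rule norm_mult3_ineq)
  also have "\<dots> \<le> norm w * norm m * \<epsilon>" using cw by (intro mult_left_mono) auto
  finally have 2: "norm (w * m * (c\<^sup>\<star> - w\<^sup>\<star>)) \<le> norm w * norm m * \<epsilon>" .
  have "c * m * c\<^sup>\<star> - w * m * w\<^sup>\<star> = (c - w) * m * c\<^sup>\<star> + w * m * (c\<^sup>\<star> - w\<^sup>\<star>)"
    by (simp add: algebra_simps)
  then have "norm (c * m * c\<^sup>\<star> - w * m * w\<^sup>\<star>) \<le> \<epsilon> * norm m * (norm w + \<epsilon>) + norm w * norm m * \<epsilon>"
    using 1 2 norm_triangle_ineq [of "(c - w) * m * c\<^sup>\<star>" "w * m * (c\<^sup>\<star> - w\<^sup>\<star>)"] by simp
  also have "\<dots> = norm m * (2 * norm w + \<epsilon>) * \<epsilon>" by (simp add: algebra_simps)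
  also have "\<dots> \<le> norm m * (2 * norm w + 1) * \<epsilon>"
    using assms(2) \<epsilon> by (intro mult_right_mono mult_left_mono) auto
  finally show ?thesis .
qed

lemma conj_diff: "k * (x - y) * l = k * x * l - k * y * (l::'a::ring)"
  by (simp add: algebra_simps)

lemma norm_conj_le:
  assumes "norm k \<le> 1" shows "norm (k * x * k\<^sup>\<star>) \<le> norm (x::'a::unital_cstar_algebra)"
proof -
  have "norm (k * x * k\<^sup>\<star>) \<le> norm k * norm x * norm k"
    using norm_mult3_ineq [of k x "k\<^sup>\<star>"] by simp
  also have "\<dots> \<le> 1 * norm x * 1" using assms by (intro mult_mono) auto
  finally show ?thesis by simp
qed

section \<open>Transfer from \<open>B\<close> to the ambient algebra\<close>

lemma unit_subequiv_all_ambient: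
  fixes B :: "'a::unital_cstar_algebra set"
  assumes large: "large_subalgebra B" and all: "unit_subequiv_all B"
  shows "unit_subequiv_all (UNIV :: 'a set)"
  unfolding unit_subequiv_all_def
proof
  have B: "unital_subalgebra B" using large by (simp add: large_subalgebra_def)
  fix b :: 'a assume "b \<in> UNIV \<inter> Pos - {0}"
  then have b: "b \<in> Pos" "b \<noteq> 0" by auto
  define x where "x = inverse (norm b) *\<^sub>R b"
  have x: "x \<in> Pos" "norm x = 1" "b = norm b *\<^sub>R x" using b by (auto simp: x_def intro: pos_scaleR)
  obtain z where z: "z \<in> Pos" "z * z = x" using pos_sqrt [OF unital_subalgebra_UNIV x(1) UNIV_I] by metis
  have zs: "z\<^sup>\<star> = z" using z by (simp add: pos_sa)
  \<comment> \<open>An error of \<open>1/20\<close> in the root \<open>z\<close>, of norm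
    \<open>1\<close>, becomes at most \<open>3/20\<close> between \<open>b0\<close> and
    \<open>X\<close>. This leaves \<open>norm b0 > 1/2\<close> and is below the \<open>1/4\<close>
    conceded later.\<close>
  have \<epsilon>: "(0::real) < 1/20" by simp
  have nz: "norm z = 1" using norm_sa_square [OF zs] x z by (simp add: power2_eq_1_iff)
      (metis norm_ge_zero not_one_le_zero neg_0_le_iff_le zero_le_one)
  obtain c g where g: "g \<in> Pos" "1 - g \<in> Pos" and c: "norm (c - z) < 1/20" "(1 - g) * c \<in> B"
    and ng: "norm ((1 - g) * x * (1 - g)) > 1 - 1/20"
    using large_subalgebraE [OF large x(1,2) sub_one [OF B] pos_one zero_neq_one [symmetric] \<epsilon>, of z] by metis
  note g1 = pos_contraction_complement [OF g]
  define X where "X = (1 - g) * x * (1 - g)"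
  define b0 where "b0 = (1 - g) * c * ((1 - g) * c)\<^sup>\<star>"
  have b0: "b0 \<in> B" "b0 \<in> Pos" unfolding b0_def
    using c sub_mult [OF B] sub_star [OF B] pos_conj' [OF pos_one, of "(1 - g) * c"] by auto
  have "b0 = (1 - g) * (c * 1 * c\<^sup>\<star>) * (1 - g)\<^sup>\<star>" "X = (1 - g) * (z * 1 * z\<^sup>\<star>) * (1 - g)\<^sup>\<star>"
    using g1(1) zs z(2) by (simp_all only: b0_def X_def star_mult mult.assoc mult_1_left)
  then have "b0 - X = (1 - g) * (c * 1 * c\<^sup>\<star> - z * 1 * z\<^sup>\<star>) * (1 - g)\<^sup>\<star>"
    by (simp only: conj_diff)
  then have "norm (b0 - X) \<le> norm (c * 1 * c\<^sup>\<star> - z * 1 * z\<^sup>\<star>)"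
    using norm_conj_le [OF g1(2)] by simp
  also have "\<dots> \<le> 3/20" using norm_mult_star_diff [of c z "1/20" 1] c nz by simp
  finally have bX: "norm (b0 - X) \<le> 3/20" .
  have nb0: "norm b0 > 1/2"
    using bX ng norm_triangle_sub [of X b0] by (simp add: X_def norm_minus_commute)
  \<comment> \<open>Since \<open>norm b0 > 1/2\<close>, \<open>- a0\<close> is not positive, so the
    positive part \<open>P\<close> is nonzero. Normalising \<open>P^2\<close> to \<open>1\<close>
    gives a coisometry \<open>s = v P\<close> with \<open>s a0 s\<^sup>\<star>\<close> positive,
    that is, \<open>s b0 s\<^sup>\<star>\<close> at least \<open>1/2\<close>.\<close>
  define a0 where "a0 = b0 - of_real (1/2)"
  have a0: "a0 \<in> B" "a0\<^sup>\<star> = a0"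
    unfolding a0_def using b0 sub_diff [OF B] sub_of_real [OF B, of "1/2"] by (auto simp: star_diff pos_sa)
  obtain P where P: "P \<in> B" "P\<^sup>\<star> = P" "P * a0 * P \<in> Pos" "P = 0 \<Longrightarrow> - a0 \<in> Pos"
    using sa_parts [OF B a0] by metis
  have "P \<noteq> 0"
  proof
    assume "P = 0"
    then have "norm b0 \<le> 1/2"
      using P(4) b0 by (intro pos_norm_le) (simp_all add: a0_def)
    with nb0 show False by simp
  qed
  then obtain v where v: "v \<in> B" "v * (P * P) * v\<^sup>\<star> = 1"
    using unit_subequiv_square [OF B all P(1,2)] by blast
  define s where "s = v * P"
  have ss: "s * s\<^sup>\<star> = 1" using v P by (simp add: s_def star_mult mult.assoc)
  then have ns: "norm s \<le> 1" using norm_mult_star [of s] by (auto simp: power2_eq_1_iff)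
  have "v * (P * a0 * P) * v\<^sup>\<star> \<in> Pos" using P by (intro pos_conj')
  moreover have "v * (P * a0 * P) * v\<^sup>\<star> = s * a0 * s\<^sup>\<star>" using P by (simp add: s_def star_mult mult.assoc)
  moreover have "s * a0 * s\<^sup>\<star> = s * b0 * s\<^sup>\<star> - of_real (1/2)"
    using ss by (simp add: a0_def of_real_def algebra_simps)
  ultimately have 1: "s * b0 * s\<^sup>\<star> - of_real (1/2) \<in> Pos" by simp
  have 2: "of_real (1/4) + s * (X - b0) * s\<^sup>\<star> \<in> Pos"
  proof (rule sa_le_norm(2))
    have "X\<^sup>\<star> = X" using g1 x by (simp add: X_def star_simps pos_sa mult.assoc)
    then show "(s * (X - b0) * s\<^sup>\<star>)\<^sup>\<star> = s * (X - b0) * s\<^sup>\<star>"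
      using b0 by (simp add: star_simps pos_sa mult.assoc)
    show "norm (s * (X - b0) * s\<^sup>\<star>) \<le> 1/4"
      using norm_conj_le [OF ns, of "X - b0"] bX by (simp add: norm_minus_commute)
  qed
  have "((1 - g) * s\<^sup>\<star>)\<^sup>\<star> * x * ((1 - g) * s\<^sup>\<star>) - of_real (1/4) =
      (s * b0 * s\<^sup>\<star> - of_real (1/2)) + (of_real (1/4) + s * (X - b0) * s\<^sup>\<star>)"
  proof -
    have "((1 - g) * s\<^sup>\<star>)\<^sup>\<star> * x * ((1 - g) * s\<^sup>\<star>) = s * X * s\<^sup>\<star>"
      by (simp only: star_mult star_star g1(1) X_def mult.assoc)
    moreover have "s * X * s\<^sup>\<star> = s * b0 * s\<^sup>\<star> + s * (X - b0) * s\<^sup>\<star>" by (simp add: algebra_simps)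
    moreover have "of_real (1/2) = (of_real (1/4) + of_real (1/4) :: 'a)" by (simp flip: of_real_add)
    ultimately show ?thesis by (simp only: algebra_simps)
  qed
  then have "((1 - g) * s\<^sup>\<star>)\<^sup>\<star> * x * ((1 - g) * s\<^sup>\<star>) - of_real (1/4) \<in> Pos"
    using pos_add [OF 1 2] by simp
  then obtain w where w: "w * x * w\<^sup>\<star> = 1"
    using conj_one_if_ge [OF unital_subalgebra_UNIV UNIV_I UNIV_I, where \<delta> = "1/4"] by (metis zero_less_divide_1_iff zero_less_numeral)
  have "(inverse (sqrt (norm b)) *\<^sub>R w) * b * (inverse (sqrt (norm b)) *\<^sub>R w)\<^sup>\<star> = 1"
  proof -
    have "inverse (sqrt (norm b)) * (norm b * inverse (sqrt (norm b))) = 1"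
      using b by (simp add: field_simps)
    then show ?thesis using w by (subst (2) x(3)) (simp add: star_scaleR)
  qed
  then show "\<exists>v\<in>UNIV. v * b * v\<^sup>\<star> = 1" by blast
qed

section \<open>Transfer from the ambient algebra to \<open>B\<close>\<close>

text \<open>If the hereditary subalgebra of \<open>B\<close> generated by \<open>b\<close> had no such \<open>h = b l b\<close>, it would be one-dimensional.
  In the ambient algebra it contains orthogonal projections \<open>q\<close> and \<open>r\<close>, and \<open>B\<close> contains an approximation
  \<open>k\<close> of \<open>q (1 - g)\<^sup>2 q\<close>, which is large at \<open>q\<close> and small at \<open>r\<close>; then \<open>h = k - t b\<^sup>2\<close> works for small \<open>t\<close>.\<close>
lemma hereditary_indefinite:
  fixes B :: "'a::unital_cstar_algebra set"
  assumes large: "large_subalgebra B" and all: "unit_subequiv_all (UNIV :: 'a set)"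
    and u: "proper_isometry_in UNIV (u :: 'a)" and b: "b \<in> B" "b\<^sup>\<star> = b" "b \<noteq> 0"
  obtains l where "l \<in> B" "l\<^sup>\<star> = l" "b * l * b \<notin> Pos" "- (b * l * b) \<notin> Pos"
proof -
  have B: "unital_subalgebra B" using large by (simp add: large_subalgebra_def)
  have u: "u\<^sup>\<star> * u = 1" "u * u\<^sup>\<star> \<noteq> 1" using u by (auto simp: proper_isometry_in_def)
  obtain v where v: "v * (b * b) * v\<^sup>\<star> = 1"
    using unit_subequiv_square [OF unital_subalgebra_UNIV all UNIV_I b(2,3)] by blast
  define s where "s = b * v\<^sup>\<star>"
  have vb: "v * b = s\<^sup>\<star>" using b by (simp add: s_def star_simps)
  have s: "s\<^sup>\<star> * s = 1" using v b by (simp add: s_def star_simps mult.assoc)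
  define e where "e = u * u\<^sup>\<star>"
  have e: "e\<^sup>\<star> = e" "e * e = e" "e \<noteq> 1" "e \<noteq> 0"
    using isometry_range [OF u(1)] u by (auto simp: e_def) (metis mult_1_right mult.assoc mult_zero_left mult_zero_right zero_neq_one)
  have sxs: "s\<^sup>\<star> * (s * y * s\<^sup>\<star>) * s = y" for y
    using s by (metis mult.assoc mult_1_left mult_1_right)
  define q where "q = s * e * s\<^sup>\<star>"
  define r where "r = s * (1 - e) * s\<^sup>\<star>"
  have q: "q\<^sup>\<star> = q" "q * q = q" "q \<noteq> 0"
    using isometry_range_projection [OF s e(1,2)] sxs [of e] e(4) by (auto simp: q_def)
  have qpos: "q \<in> Pos" using pos_square [OF q(1)] q by simp
  have nq: "norm q = 1"
    using norm_sa_square [OF q(1)] q by (simp add: power2_eq_square)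
  have qr: "q * r = 0"
  proof -
    have "q * r = s * e * (s\<^sup>\<star> * s) * ((1 - e) * s\<^sup>\<star>)" by (simp only: q_def r_def mult.assoc)
    also have "\<dots> = s * (e * (1 - e)) * s\<^sup>\<star>" unfolding s by (simp only: mult_1_right mult.assoc)
    also have "e * (1 - e) = 0" using e by (simp add: algebra_simps)
    finally show ?thesis by simp
  qed
  have br: "b * r \<noteq> 0"
  proof
    assume "b * r = 0"
    then have "v * b * r = 0" by (simp add: mult.assoc)
    then have "s\<^sup>\<star> * r * s = 0" by (simp add: vb)
    then show False using sxs [of "1 - e"] e(3) by (simp add: r_def mult.assoc)
  qed
  \<comment> \<open>Chosen so that \<open>a b = q\<close>: an approximant \<open>c\<close> of
    \<open>a\<close> then gives \<open>d = (1 - g) c b\<close> close to \<open>(1 - g) q\<close>,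
    with the right factor \<open>b\<close> already in place.\<close>
  define a where "a = s * e * v"
  have ab: "a * b = q" by (simp add: a_def q_def mult.assoc vb)
  \<comment> \<open>The norm of \<open>t b^2\<close> is \<open>1/4\<close>, while
    \<open>norm d\<close> will exceed \<open>1/2\<close>, so subtracting \<open>t b^2\<close> from
    \<open>d\<^sup>\<star> d\<close> cannot make it negative.\<close>
  define t where "t = 1 / (4 * (norm b)\<^sup>2)"
  have t: "t > 0" "t * (norm b)\<^sup>2 = 1/4" using b(3) by (simp_all add: t_def)
  define R where "R = norm r + 1"
  have R: "R > 0" "norm r \<le> R" by (simp_all add: R_def add_nonneg_pos)
  \<comment> \<open>The bound \<open>1/4\<close> keeps \<open>norm d\<close> above
    \<open>3/4 - 1/4\<close>. The other bound makes \<open>d r\<close>, close to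
    \<open>(1 - g) q r = 0\<close>, smaller than \<open>sqrt t * norm (b * r)\<close>, which refutes
    positivity at \<open>r\<close>.\<close>
  define \<eta> where "\<eta> = min (1/4) (sqrt t * norm (b * r) / (2 * R))"
  have \<eta>: "\<eta> > 0" using t br R by (simp add: \<eta>_def)
  define \<epsilon> where "\<epsilon> = min (1/4) (\<eta> / norm b)"
  have \<epsilon>: "\<epsilon> > 0" "\<epsilon> \<le> 1/4" "\<epsilon> * norm b \<le> \<eta>"
    using \<eta> b(3) by (auto simp: \<epsilon>_def min_def field_simps)
  obtain c g where g: "g \<in> Pos" "1 - g \<in> Pos" and c: "norm (c - a) < \<epsilon>" "(1 - g) * c \<in> B"
    and ng: "norm ((1 - g) * q * (1 - g)) > 1 - \<epsilon>"
    using large_subalgebraE [OF large qpos nq sub_one [OF B] pos_one zero_neq_one [symmetric] \<epsilon>(1), of a] by metis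
  note g1 = pos_contraction_complement [OF g]
  define d where "d = (1 - g) * c * b"
  have "d - (1 - g) * q = (1 - g) * (c - a) * b" by (simp add: d_def algebra_simps ab)
  then have "norm (d - (1 - g) * q) \<le> norm (1 - g) * norm (c - a) * norm b"
    by (simp only: norm_mult3_ineq)
  also have "\<dots> \<le> 1 * \<epsilon> * norm b" using g1 c \<epsilon>(1) by (intro mult_mono) auto
  finally have dq: "norm (d - (1 - g) * q) \<le> \<eta>" using \<epsilon> by simp
  have "(norm ((1 - g) * q))\<^sup>2 = norm ((1 - g) * q * (1 - g))"
  proof -
    have "(1 - g) * q * ((1 - g) * q)\<^sup>\<star> = (1 - g) * (q * q) * (1 - g)"
      by (simp only: star_mult g1(1) q(1) mult.assoc)
    then show ?thesis using norm_mult_star [of "(1 - g) * q"] by (simp only: q(2))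
  qed
  then have "(norm ((1 - g) * q))\<^sup>2 > (3/4)\<^sup>2" using ng \<epsilon> by (simp add: power2_eq_square)
  then have "norm ((1 - g) * q) > 3/4" by (rule power2_less_imp_less) simp
  then have nd: "norm d > 1/2"
    using dq norm_triangle_sub [of "(1 - g) * q" d] by (simp add: \<eta>_def norm_minus_commute)
  have dr: "norm (d * r) < sqrt t * norm (b * r)"
  proof -
    have "d * r = (d - (1 - g) * q) * r" using qr by (simp add: algebra_simps)
    then have "norm (d * r) \<le> norm (d - (1 - g) * q) * norm r" by (metis norm_mult_ineq)
    also have "\<dots> \<le> (sqrt t * norm (b * r) / (2 * R)) * R"
      using dq t R by (intro mult_mono) (auto simp: \<eta>_def)
    also have "\<dots> = sqrt t * norm (b * r) / 2" using R by simp
    also have "\<dots> < sqrt t * norm (b * r)" using t br by simp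
    finally show ?thesis .
  qed
  define l where "l = ((1 - g) * c)\<^sup>\<star> * ((1 - g) * c) - of_real t"
  have "l \<in> B" unfolding l_def using c sub_mult [OF B] sub_star [OF B] sub_diff [OF B] sub_of_real [OF B] by auto
  moreover have "l\<^sup>\<star> = l" by (simp only: l_def star_diff star_mult star_star star_of_real mult.assoc)
  moreover have h: "b * l * b = d\<^sup>\<star> * d - t *\<^sub>R (b * b)"
  proof -
    have "b * l * b = b * (((1 - g) * c)\<^sup>\<star> * ((1 - g) * c)) * b - t *\<^sub>R (b * b)"
      by (simp add: l_def left_diff_distrib right_diff_distrib of_real_def)
    moreover have "d\<^sup>\<star> = b * ((1 - g) * c)\<^sup>\<star>"
      by (simp only: d_def star_mult [of "(1 - g) * c" b] b(2))
    then have "d\<^sup>\<star> * d = b * (((1 - g) * c)\<^sup>\<star> * ((1 - g) * c)) * b"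
      by (simp only: d_def mult.assoc)
    ultimately show ?thesis by simp
  qed
  have "- (b * l * b) \<notin> Pos"
  proof
    assume "- (b * l * b) \<in> Pos"
    then have "norm (d\<^sup>\<star> * d) \<le> norm (t *\<^sub>R (b * b))"
      by (intro pos_mono_norm pos_star_mult) (simp add: h)
    then have "(norm d)\<^sup>2 \<le> (1/2)\<^sup>2"
      using t norm_sa_square [OF b(2)] by (simp add: norm_star_mult power2_eq_square)
    then have "norm d \<le> 1/2" by (rule power2_le_imp_le) simp
    with nd show False by simp
  qed
  moreover have "b * l * b \<notin> Pos"
  proof
    assume "b * l * b \<in> Pos"
    then have "r\<^sup>\<star> * (d\<^sup>\<star> * d - t *\<^sub>R (b * b)) * r \<in> Pos" unfolding h by (rule pos_conj)
    moreover have "r\<^sup>\<star> * (d\<^sup>\<star> * d - t *\<^sub>R (b * b)) * r = (d * r)\<^sup>\<star> * (d * r) - t *\<^sub>R ((b * r)\<^sup>\<star> * (b * r))"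
      by (simp add: star_mult b algebra_simps)
    ultimately have "norm (t *\<^sub>R ((b * r)\<^sup>\<star> * (b * r))) \<le> norm ((d * r)\<^sup>\<star> * (d * r))"
      using t by (intro pos_mono_norm pos_scaleR pos_star_mult) auto
    then have "(sqrt t * norm (b * r))\<^sup>2 \<le> (norm (d * r))\<^sup>2"
      using t by (simp add: norm_star_mult power_mult_distrib)
    then have "sqrt t * norm (b * r) \<le> norm (d * r)" by (rule power2_le_imp_le) simp
    with dr show False by simp
  qed
  ultimately show thesis using that by blast
qed

text \<open>The two failures of positivity are what makes both parts of \<open>b l b\<close>
  nonzero. The last two relations factor \<open>P^2\<close> and \<open>N^2\<close> through
  \<open>b\<close>.\<close>

lemma large_indefinite_parts:
  fixes B :: "'a::unital_cstar_algebra set"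
  assumes large: "large_subalgebra B" and all: "unit_subequiv_all (UNIV :: 'a set)"
    and u: "proper_isometry_in UNIV (u :: 'a)" and b: "b \<in> B" "b\<^sup>\<star> = b" "b \<noteq> 0"
  obtains l P N where "l \<in> B" "P \<in> B" "N \<in> B" "P\<^sup>\<star> = P" "N\<^sup>\<star> = N" "P \<noteq> 0" "N \<noteq> 0"
    "P * N = 0" "N * P = 0" "P * (b * l * b) = P * P" "N * (b * l * b) = - (N * N)"
proof -
  have B: "unital_subalgebra B" using large by (simp add: large_subalgebra_def)
  obtain l where l: "l \<in> B" "l\<^sup>\<star> = l" "b * l * b \<notin> Pos" "- (b * l * b) \<notin> Pos"
    using hereditary_indefinite [OF assms] by blast
  have h: "b * l * b \<in> B" "(b * l * b)\<^sup>\<star> = b * l * b"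
    using l b sub_mult [OF B] by (auto simp: star_mult mult.assoc)
  show thesis using sa_parts [OF B h] l that by metis
qed

lemma unit_subequiv_all_large:
  fixes B :: "'a::unital_cstar_algebra set"
  assumes large: "large_subalgebra B" and all: "unit_subequiv_all (UNIV :: 'a set)"
    and u: "proper_isometry_in UNIV (u :: 'a)"
  shows "unit_subequiv_all B"
  unfolding unit_subequiv_all_def
proof
  have B: "unital_subalgebra B" using large by (simp add: large_subalgebra_def)
  fix b assume "b \<in> B \<inter> Pos - {0}"
  then have b: "b \<in> B" "b \<in> Pos" "b\<^sup>\<star> = b" "b \<noteq> 0" by (auto simp: pos_sa)
  obtain l P N where l: "l \<in> B" and PN: "P \<in> B" "N \<in> B" "P\<^sup>\<star> = P" "N\<^sup>\<star> = N" "P \<noteq> 0" "N \<noteq> 0"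
    "P * N = 0" "N * P = 0" and h: "P * (b * l * b) = P * P" "N * (b * l * b) = - (N * N)"
    using large_indefinite_parts [OF large all u b(1,3,4)] by metis
  \<comment> \<open>Fourth powers arise because the final product takes one \<open>P^2\<close> from
    \<open>X (b l b)\<close> and another from \<open>Y\<close>; likewise for
    \<open>N\<close>.\<close>
  define P4 where "P4 = (P * P) * (P * P)"
  define N4 where "N4 = (N * N) * (N * N)"
  have sq: "P * P \<in> B" "(P * P)\<^sup>\<star> = P * P" "P * P \<noteq> 0" "N * N \<in> B" "(N * N)\<^sup>\<star> = N * N" "N * N \<noteq> 0"
    using PN sub_mult [OF B] by (auto simp: star_mult sa_mult_self_eq_zero)
  obtain w where w: "w * P4 * w\<^sup>\<star> = 1"
    using unit_subequiv_square [OF unital_subalgebra_UNIV all UNIV_I sq(2,3)] unfolding P4_def by blast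
  have P4: "P4 \<in> B" "P4\<^sup>\<star> = P4" "P4 \<noteq> 0" using sq w sub_mult [OF B] by (auto simp: P4_def star_mult)
  have N4: "N4 \<in> B" "N4 \<in> Pos" "N4 \<noteq> 0"
    using sq sub_mult [OF B] pos_square sa_mult_self_eq_zero by (auto simp: N4_def)
  define M where "M = norm P4 * (2 * norm w + 1)"
  have M: "M > 0" using P4 by (simp add: M_def add_nonneg_pos)
  \<comment> \<open>\<open>M \<epsilon>\<close> bounds the error of the \<open>P\<close> piece by
    \<open>1/8\<close>. The \<open>N\<close> piece is allowed another \<open>1/8\<close>.\<close>
  define \<epsilon> where "\<epsilon> = min 1 (1 / (8 * M))"
  have \<epsilon>: "\<epsilon> > 0" "\<epsilon> \<le> 1" "M * \<epsilon> \<le> 1/8"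
    using M by (auto simp: \<epsilon>_def min_def field_simps)
  obtain c g where g: "g \<in> B" "g \<in> Pos" "1 - g \<in> Pos" and c: "norm (c - w) < \<epsilon>" "(1 - g) * c \<in> B"
    and sub: "cuntz_subequiv B g N4"
    using large_subalgebraE [OF large pos_one norm_one N4 \<epsilon>(1), of w] by metis
  note g1 = pos_contraction_complement [OF g(2,3)]
  have gs: "g\<^sup>\<star> = g" using g by (simp add: pos_sa)
  define y where "y = (1 - g) * c"
  have yB: "y \<in> B" using c by (simp add: y_def)
  have "y * P4 * y\<^sup>\<star> = (1 - g) * (c * P4 * c\<^sup>\<star>) * (1 - g)\<^sup>\<star>"
    by (simp only: y_def star_mult mult.assoc)
  then have "y * P4 * y\<^sup>\<star> - (1 - g) * (1 - g) = (1 - g) * (c * P4 * c\<^sup>\<star> - w * P4 * w\<^sup>\<star>) * (1 - g)\<^sup>\<star>"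
    by (simp only: conj_diff w g1(1) mult_1_right)
  then have "norm (y * P4 * y\<^sup>\<star> - (1 - g) * (1 - g)) \<le> norm (c * P4 * c\<^sup>\<star> - w * P4 * w\<^sup>\<star>)"
    using norm_conj_le [OF g1(2)] by simp
  also have "\<dots> \<le> M * \<epsilon>" unfolding M_def using c \<epsilon> by (intro norm_mult_star_diff) auto
  finally have 1: "norm (y * P4 * y\<^sup>\<star> - (1 - g) * (1 - g)) \<le> 1/8" using \<epsilon> by simp
  obtain f where f: "\<And>n. f n \<in> B" "(\<lambda>n. f n * N4 * (f n)\<^sup>\<star>) \<longlonglongrightarrow> g"
    using sub by (auto simp: cuntz_subequiv_def)
  obtain n where "dist (f n * N4 * (f n)\<^sup>\<star>) g < 1/8"
    using metric_LIMSEQ_D [OF f(2), of "1/8"] by auto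
  then obtain v where v: "v \<in> B" and 2: "norm (v * N4 * v\<^sup>\<star> - g) \<le> 1/8"
    using f(1) [of n] by (metis dist_norm less_imp_le)
  define T where "T = y * P4 * y\<^sup>\<star> + v * N4 * v\<^sup>\<star>"
  define E where "E = T - (1 - g) * (1 - g) - g"
  have TB: "T \<in> B" unfolding T_def
    using yB v P4 N4 by (intro sub_add [OF B] sub_mult [OF B] sub_star [OF B])
  have Ts: "T\<^sup>\<star> = T" using P4 N4 by (simp add: T_def star_simps pos_sa mult.assoc)
  have "E\<^sup>\<star> = E" unfolding E_def by (simp only: star_diff star_mult Ts g1 gs star_one)
  moreover have "E = (y * P4 * y\<^sup>\<star> - (1 - g) * (1 - g)) + (v * N4 * v\<^sup>\<star> - g)" by (simp add: E_def T_def)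
  then have "norm E \<le> 1/4" using 1 2 norm_triangle_mono by fastforce
  ultimately have "of_real (1/4) + E \<in> Pos" by (rule sa_le_norm(2))
  \<comment> \<open>Completing the square: \<open>(1 - g)^2 + g = (g - 1/2)^2 + 3/4\<close>. The
    error \<open>E\<close> costs at most \<open>1/4\<close>, so \<open>T\<close> is at least
    \<open>1/2\<close>.\<close>
  moreover have "(g - of_real (1/2)) * (g - of_real (1/2)) \<in> Pos"
    using gs by (intro pos_square) (simp add: star_diff)
  ultimately have "(g - of_real (1/2)) * (g - of_real (1/2)) + (of_real (1/4) + E) \<in> Pos"
    by (metis pos_add)
  moreover have "(g - of_real (1/2)) * (g - of_real (1/2)) + (of_real (1/4) + E) = T - of_real (1/2)"
  proof -
    have "(1/2::real) *\<^sub>R g + (1/2) *\<^sub>R g = g" by (simp flip: scaleR_left_distrib)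
    moreover have "(1/4::real) *\<^sub>R (1::'a) + (1/4) *\<^sub>R 1 + (1/2) *\<^sub>R 1 = 1" by (simp flip: scaleR_left_distrib)
    ultimately show ?thesis by (simp add: E_def of_real_def algebra_simps)
  qed
  ultimately have "invertible_in B T" by (intro invertible_in_if_ge [OF B TB, where \<delta> = "1/2"]) simp_all
  then obtain k where k: "k \<in> B" "k * T = 1" by (auto simp: invertible_in_def)
  \<comment> \<open>The minus sign cancels the one in \<open>N (b l b) = - N^2\<close>;
    orthogonality removes the mixed terms, so \<open>X (b l b) Y = T\<close>.\<close>
  define X where "X = y * P - v * N"
  define Y where "Y = P * P * y\<^sup>\<star> + N * N * v\<^sup>\<star>"
  have XY: "X \<in> B" "Y \<in> B" unfolding X_def Y_def
    using yB v PN by (auto intro!: sub_add [OF B] sub_diff [OF B] sub_mult [OF B] sub_star [OF B])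
  have "X * (b * l * b) = y * (P * P) + v * (N * N)"
    by (simp add: X_def left_diff_distrib mult.assoc [of _ _ "b * l * b"] h)
  then have "X * (b * l * b) * Y = y * (P * P) * Y + v * (N * N) * Y" by (simp add: distrib_right)
  also have "\<dots> = T"
  proof -
    have "y * (P * P) * Y = y * P4 * y\<^sup>\<star> + y * (P * (P * N)) * (N * v\<^sup>\<star>)"
      "v * (N * N) * Y = v * N4 * v\<^sup>\<star> + v * (N * (N * P)) * (P * y\<^sup>\<star>)"
      by (simp_all only: Y_def P4_def N4_def distrib_left mult.assoc add.commute)
    then show ?thesis using PN by (simp add: T_def)
  qed
  finally have "(k * X) * b * (l * b * Y) = 1" using k by (simp add: mult.assoc)
  moreover have "k * X \<in> B" "l * b * Y \<in> B" using k l b XY sub_mult [OF B] by auto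
  ultimately obtain v where "v \<in> B" "v * b * v\<^sup>\<star> = 1"
    using conj_one_if_mult_one [OF B b(1,2)] by metis
  then show "\<exists>v\<in>B. v * b * v\<^sup>\<star> = 1" by blast
qed

text \<open>The orthogonal parts are taken for \<open>b = 1\<close>. Normalising \<open>P^2\<close>
  gives the isometry \<open>P v\<^sup>\<star>\<close>, whose range projection is annihilated by the
  nonzero \<open>N\<close>.\<close>

lemma proper_isometry_large:
  fixes B :: "'a::unital_cstar_algebra set"
  assumes large: "large_subalgebra B" and all: "unit_subequiv_all (UNIV :: 'a set)"
    and u: "proper_isometry_in UNIV (u :: 'a)"
  obtains s where "proper_isometry_in B s"
proof -
  have B: "unital_subalgebra B" using large by (simp add: large_subalgebra_def)
  obtain P N where PN: "P \<in> B" "P\<^sup>\<star> = P" "P \<noteq> 0" "N \<noteq> 0" "N * P = 0"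
    using large_indefinite_parts [OF large all u sub_one [OF B]] by (metis star_one zero_neq_one)
  obtain v where v: "v \<in> B" "v * (P * P) * v\<^sup>\<star> = 1"
    using unit_subequiv_square [OF B unit_subequiv_all_large [OF large all u] PN(1,2,3)] by blast
  have "(P * v\<^sup>\<star>)\<^sup>\<star> * (P * v\<^sup>\<star>) = 1" using v PN by (simp add: star_simps mult.assoc)
  moreover have "N * (P * v\<^sup>\<star> * (P * v\<^sup>\<star>)\<^sup>\<star>) = 0" using PN by (simp flip: mult.assoc)
  then have "P * v\<^sup>\<star> * (P * v\<^sup>\<star>)\<^sup>\<star> \<noteq> 1" using PN by auto
  moreover have "P * v\<^sup>\<star> \<in> B" using v PN sub_mult [OF B] sub_star [OF B] by auto
  ultimately show thesis using that by (auto simp: proper_isometry_in_def)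
qed

theorem proposition6p17:
  fixes B :: "'a::unital_cstar_algebra set"
  assumes "infinite_dimensional (UNIV :: 'a set)"
    and "simple_cstar (UNIV :: 'a set)"
    and "large_subalgebra B"
  shows "purely_infinite (UNIV :: 'a set) \<longleftrightarrow> purely_infinite B"
proof -
  have B: "unital_subalgebra B" using assms(3) by (simp add: large_subalgebra_def)
  have "proper_isometry_in UNIV u" if "proper_isometry_in B u" for u
    using that by (auto simp: proper_isometry_in_def)
  then show ?thesis
    unfolding purely_infinite_iff [OF unital_subalgebra_UNIV] purely_infinite_iff [OF B]
    using unit_subequiv_all_ambient [OF assms(3)] unit_subequiv_all_large [OF assms(3)]
      proper_isometry_large [OF assms(3)] by metis
qed

end
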